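(* There exists a finitely generated weakly amenable non-amenable group which contains no non-abelian free subgroups.
   Context: For a (discrete) finitely generated group $G$, acting on $\ell^2(G)=L^2(G)$ by the left regular representation, and a finite subset $S\subseteq G$, let $\alpha(G,S)$ be the supremum of all $\varepsilon\ge 0$ such that for every $v\in \ell^2(G)$ with $\|v\|=1$ there exists $s\in S$ with $\|sv-v\|\ge\varepsilon$. Put $\alpha(G)=\inf_S\alpha(G,S)$, where $S$ ranges over all finite generating sets of $G$. A finitely generated group $G$ is called weakly amenable (in the sense of this paper) if $\alpha(G)=0$. A (discrete) group is amenable if it admits a finitely additive left-invariant measure $\mu$ on all its subsets with $\mu(G)=1$. *)

theory Defs
  imports "HOL-Analysis.Analysis" "HOL-Algebra.Coset" "HOL-Algebra.Generated_Groups"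
begin

definition generating_set :: "('a, 'b) monoid_scheme \<Rightarrow> 'a set \<Rightarrow> bool" where
  "generating_set G S \<longleftrightarrow> S \<subseteq> carrier G \<and> generate G S = carrier G"

definition finitely_generated :: "('a, 'b) monoid_scheme \<Rightarrow> bool" where
  "finitely_generated G \<longleftrightarrow> (\<exists>S. finite S \<and> generating_set G S)"

text \<open>
  Elements of $\ell^2(G)$ are represented by functions on the whole type; values outside
  \<^term>\<open>carrier G\<close> are irrelevant, since the norm and the translation action at points of the
  carrier only look at values on the carrier.
\<close>

definition ell2 :: "('a, 'b) monoid_scheme \<Rightarrow> ('a \<Rightarrow> complex) set" where
  "ell2 G = {v. (\<lambda>x. (cmod (v x))\<^sup>2) summable_on carrier G}"

definition ell2_norm :: "('a, 'b) monoid_scheme \<Rightarrow> ('a \<Rightarrow> complex) \<Rightarrow> real" where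
  "ell2_norm G v = sqrt (\<Sum>\<^sub>\<infinity>x\<in>carrier G. (cmod (v x))\<^sup>2)"

definition left_regular ::
    "('a, 'b) monoid_scheme \<Rightarrow> 'a \<Rightarrow> ('a \<Rightarrow> complex) \<Rightarrow> ('a \<Rightarrow> complex)" where
  "left_regular G s v = (\<lambda>x. v (inv\<^bsub>G\<^esub> s \<otimes>\<^bsub>G\<^esub> x))"

text \<open>
  The supremum and the infimum are taken in \<^typ>\<open>ennreal\<close>, so that the supremum of the empty
  set is \<open>0\<close>. This matters only for \<open>S = {}\<close>, which generates only the trivial group.
\<close>

definition alpha_gen :: "('a, 'b) monoid_scheme \<Rightarrow> 'a set \<Rightarrow> ennreal" where
  "alpha_gen G S = Sup {ennreal \<epsilon> | \<epsilon>. 0 \<le> \<epsilon> \<and>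
     (\<forall>v\<in>ell2 G. ell2_norm G v = 1 \<longrightarrow>
        (\<exists>s\<in>S. ell2_norm G (\<lambda>x. left_regular G s v x - v x) \<ge> \<epsilon>))}"

definition alpha :: "('a, 'b) monoid_scheme \<Rightarrow> ennreal" where
  "alpha G = Inf {alpha_gen G S | S. finite S \<and> generating_set G S}"

definition weakly_amenable :: "('a, 'b) monoid_scheme \<Rightarrow> bool" where
  "weakly_amenable G \<longleftrightarrow> finitely_generated G \<and> alpha G = 0"

definition amenable :: "('a, 'b) monoid_scheme \<Rightarrow> bool" where
  "amenable G \<longleftrightarrow> (\<exists>\<mu> :: 'a set \<Rightarrow> real.
     (\<forall>A. A \<subseteq> carrier G \<longrightarrow> 0 \<le> \<mu> A) \<and>
     (\<forall>A B. A \<subseteq> carrier G \<longrightarrow> B \<subseteq> carrier G \<longrightarrow> A \<inter> B = {} \<longrightarrow> \<mu> (A \<union> B) = \<mu> A + \<mu> B) \<and>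
     (\<forall>g\<in>carrier G. \<forall>A. A \<subseteq> carrier G \<longrightarrow> \<mu> (g <#\<^bsub>G\<^esub> A) = \<mu> A) \<and>
     \<mu> (carrier G) = 1)"

text \<open>
  A word over \<open>X\<close> is a list of letters \<open>(b, x)\<close> with \<open>x \<in> X\<close>, where \<open>(True, x)\<close> stands for \<open>x\<close>
  and \<open>(False, x)\<close> for the inverse of \<open>x\<close>.
\<close>

definition reduced_word :: "(bool \<times> 'a) list \<Rightarrow> bool" where
  "reduced_word w \<longleftrightarrow> successively (\<lambda>(a, x) (b, y). \<not> (x = y \<and> a \<noteq> b)) w"

definition word_value :: "('a, 'b) monoid_scheme \<Rightarrow> (bool \<times> 'a) list \<Rightarrow> 'a" where
  "word_value G w =
     foldr (\<lambda>(b, x) g. (if b then x else inv\<^bsub>G\<^esub> x) \<otimes>\<^bsub>G\<^esub> g) w \<one>\<^bsub>G\<^esub>"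

definition free_basis :: "('a, 'b) monoid_scheme \<Rightarrow> 'a set \<Rightarrow> bool" where
  "free_basis G X \<longleftrightarrow> generating_set G X \<and>
     (\<forall>w. w \<noteq> [] \<longrightarrow> snd ` set w \<subseteq> X \<longrightarrow> reduced_word w \<longrightarrow> word_value G w \<noteq> \<one>\<^bsub>G\<^esub>)"

definition free_group :: "('a, 'b) monoid_scheme \<Rightarrow> bool" where
  "free_group G \<longleftrightarrow> group G \<and> (\<exists>X. free_basis G X)"

definition has_nonabelian_free_subgroup :: "('a, 'b) monoid_scheme \<Rightarrow> bool" where
  "has_nonabelian_free_subgroup G \<longleftrightarrow>
     (\<exists>H. subgroup H G \<and> free_group (G\<lparr>carrier := H\<rparr>) \<and> \<not> comm_group (G\<lparr>carrier := H\<rparr>))"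

text \<open>
  Finitely generated groups are countable, hence isomorphic to groups whose carrier is a set of
  natural numbers, and all of the above notions are invariant under isomorphism. Existence of a
  finitely generated group with such properties may therefore be expressed over
  \<^typ>\<open>nat monoid\<close>.
\<close>

end

theory Submission
  imports Defs "HOL-Library.Z2" "HOL-Library.Set_Algebras"
begin

text \<open>
  The example is the lamplighter group \<open>H wr \<int>\<close> over the group \<open>H\<close> with two generators \<open>a\<close>, \<open>b\<close> and
  one relator \<open>s\<^sup>n = 1\<close>, \<open>n = exponent s\<close>, for every positive word \<open>s\<close> in \<open>a\<close>, \<open>b\<close>.  The exponents are powers
  of 2 that grow so fast that the sum of their reciprocals is at most \<open>1/2\<close>.

  No free subgroups.  Every element of \<open>H\<close> has finite order, hence so does every element in the kernel
  of the projection \<open>H wr \<int> \<rightarrow> \<int>\<close>.  A commutator lies in this kernel, but the commutator of two distinct elements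
  of a free basis has infinite order.

  Weak amenability.  The group is generated by the unit translation together with the lamp \<open>a\<close> at
  position \<open>0\<close> and the lamp \<open>b\<close> at position \<open>n\<close>.  As long as one moves by less than \<open>n\<close>, the lamps
  \<open>a\<close> and \<open>b\<close> act at disjoint sets of positions and never meet, so on this scale the group looks like
  a lamplighter group over the product of the finite cyclic groups generated by \<open>a\<close> and \<open>b\<close>, which is
  amenable.  This gives finite sets that all three generators move by a proportion of at most \<open>1/n\<close>
  (\<open>lamplighter_folner\<close>), and their normalised indicators are almost invariant vectors
  (\<open>weakly_amenable_if_folner\<close>).

  Non-amenability.  Reading off the lamp at position \<open>0\<close> is an \<open>H\<close>-equivariant map \<open>H wr \<int> \<rightarrow> H\<close>, so an
  invariant measure on \<open>H wr \<int>\<close> would push forward to one on \<open>H\<close>.  On \<open>H\<close> this is impossible because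
  finite sets expand (\<open>torsion_expanding\<close>), which by Hall's theorem produces a paradoxical
  decomposition (\<open>expanding_imp_paradox\<close>, \<open>not_amenable_if_paradox\<close>).

  The heart is the expansion, which is a dimension count over the field with two elements.  Consider
  functions \<open>\<phi>\<close> from the edges of the Cayley graph of \<open>H\<close> to this field whose sum along each relator loop
  vanishes, and suppose that \<open>H\<close> had finite sets with arbitrarily small boundary.

  \<^item> If \<open>F\<close> is such a set, then \<open>\<phi>\<close> is a gradient on the edges that start in \<open>F\<close>.  So \<open>\<phi>\<close> has at most about
    \<open>2\<^sup>|\<^sup>F\<^sup>|\<close> restrictions to these edges, and only a finite set \<open>R\<close> of relators is used to see this
    (\<open>card_traces_closed_cochains_le\<close>).

  \<^item> Let \<open>F'\<close> be another such set, whose boundary is small even relative to \<open>F\<close> and \<open>R\<close>.  There are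
    \<open>2|F'|\<close> edges starting in \<open>F'\<close>, and the relator \<open>s\<^sup>n\<close> imposes at most about \<open>|F'|/n\<close> conditions:  if \<open>s\<close>
    has order \<open>n\<close> in \<open>H\<close>, then the loops that start at \<open>g\<close>, \<open>gs\<close>, \<open>gs\<^sup>2\<close>, ... are the same closed path,
    and if the order is smaller, then the loop runs through a shorter closed path an even number of
    times and the condition is void modulo 2 (\<open>relator_conditions\<close>).  As the reciprocals of the
    exponents add up to at most \<open>1/2\<close>, the exponent of 2 in the number of restrictions to \<open>F'\<close> is at
    least about \<open>3/2\<close> per vertex.

  \<^item> Shearer's inequality for the translates of \<open>F\<close> that meet \<open>F'\<close> says that this exponent per vertex
    is at most about that for \<open>F\<close>, which is \<open>1\<close> (\<open>shearer_traces\<close>).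
\<close>

section \<open>Hall's theorem, expansion and invariant measures\<close>

text \<open>
  Infinite index sets are allowed.  Deleting elements from the sets \<open>A i\<close> while keeping Hall's condition
  is possible up to a maximal deletion by Zorn's lemma; finiteness of the sets makes the condition
  survive unions of chains.  After a maximal deletion every set is a singleton (Rado): if both \<open>x\<close> and \<open>y\<close>
  in the same set were indispensable, the two violations of Hall's condition that their removal causes
  would add up, by submodularity of the cardinality of a union, to a violation already present.
\<close>

lemma hall_marriage:
  fixes A :: "'i \<Rightarrow> 'a set"
  assumes fin: "\<And>i. finite (A i)"
    and hall: "\<And>J. finite J \<Longrightarrow> card J \<le> card (\<Union>i\<in>J. A i)"
  shows "\<exists>f. inj f \<and> (\<forall>i. f i \<in> A i)"
proof -
  define B where "B D i = A i - D `` {i}" for D :: "('i \<times> 'a) set" and i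
  define \<D> where "\<D> = {D. \<forall>J. finite J \<longrightarrow> card J \<le> card (\<Union>i\<in>J. B D i)}"
  have "\<exists>M\<in>\<D>. \<forall>X\<in>\<D>. M \<subseteq> X \<longrightarrow> X = M"
  proof (rule subset_Zorn')
    fix C assume chain: "subset.chain \<D> C"
    show "\<Union>C \<in> \<D>"
    proof (cases "C = {}")
      case True
      then show ?thesis using hall by (simp add: \<D>_def B_def)
    next
      case False
      have "card J \<le> card (\<Union>i\<in>J. B (\<Union>C) i)" if J: "finite J" for J
      proof -
        have "finite (\<Union>C \<inter> Sigma J A)" using J fin by (auto intro: finite_SigmaI)
        then obtain D where D: "D \<in> C" "\<Union>C \<inter> Sigma J A \<subseteq> D"
          using finite_subset_Union_chain[OF _ _ False chain] by (metis inf_le1)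
        have "B (\<Union>C) i = B D i" if "i \<in> J" for i
          using D that unfolding B_def by blast
        moreover have "D \<in> \<D>" using D chain unfolding subset.chain_def by blast
        ultimately show ?thesis using J by (simp add: \<D>_def)
      qed
      then show ?thesis by (simp add: \<D>_def)
    qed
  qed
  then obtain D where D: "D \<in> \<D>" and max: "\<And>X. X \<in> \<D> \<Longrightarrow> D \<subseteq> X \<Longrightarrow> X = D" by blast
  have finB: "finite (B D i)" for i using fin by (simp add: B_def)
  have hallB: "card J \<le> card (\<Union>i\<in>J. B D i)" if "finite J" for J
    using D that by (simp add: \<D>_def)
  \<comment> \<open>Removing \<open>x\<close> violates Hall's condition, by maximality of \<open>D\<close>; the violating index set must
    contain \<open>i\<close>, and \<open>P\<close> is the rest of it.\<close>
  have drop: "\<exists>P. finite P \<and> i \<notin> P \<and> card ((B D i - {x}) \<union> (\<Union>j\<in>P. B D j)) \<le> card P"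
    if x: "x \<in> B D i" for i x
  proof -
    let ?D = "insert (i, x) D"
    have B': "B ?D j = (if j = i then B D i - {x} else B D j)" for j by (auto simp: B_def)
    have "(i, x) \<notin> D" using x by (auto simp: B_def)
    then have "?D \<notin> \<D>" using max[of ?D] by blast
    then obtain J where J: "finite J" "card J > card (\<Union>j\<in>J. B ?D j)"
      unfolding \<D>_def by (auto simp: not_le)
    have iJ: "i \<in> J"
    proof (rule ccontr)
      assume "i \<notin> J"
      then have "(\<Union>j\<in>J. B ?D j) = (\<Union>j\<in>J. B D j)" by (auto simp: B')
      then show False using hallB[OF J(1)] J(2) by simp
    qed
    have "(\<Union>j\<in>J. B ?D j) = (B D i - {x}) \<union> (\<Union>j\<in>J - {i}. B D j)"
      using iJ by (auto simp: B' split: if_splits)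
    moreover have "card J = Suc (card (J - {i}))" using iJ J(1) by (metis card_Suc_Diff1)
    ultimately show ?thesis using J by (intro exI[of _ "J - {i}"]) auto
  qed
  have uniq: "x = y" if x: "x \<in> B D i" and y: "y \<in> B D i" for i x y
  proof (rule ccontr)
    assume "x \<noteq> y"
    obtain P where P: "finite P" "i \<notin> P" "card ((B D i - {x}) \<union> (\<Union>j\<in>P. B D j)) \<le> card P"
      using drop[OF x] by blast
    obtain Q where Q: "finite Q" "i \<notin> Q" "card ((B D i - {y}) \<union> (\<Union>j\<in>Q. B D j)) \<le> card Q"
      using drop[OF y] by blast
    let ?U = "(B D i - {x}) \<union> (\<Union>j\<in>P. B D j)" and ?V = "(B D i - {y}) \<union> (\<Union>j\<in>Q. B D j)"
    have fUV: "finite ?U" "finite ?V" using P Q finB by auto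
    have "?U \<union> ?V = (\<Union>j\<in>insert i (P \<union> Q). B D j)"
      using \<open>x \<noteq> y\<close> x y by auto
    then have "card (?U \<union> ?V) \<ge> Suc (card (P \<union> Q))"
      using hallB[of "insert i (P \<union> Q)"] P Q by simp
    moreover have "card (\<Union>j\<in>P \<inter> Q. B D j) \<le> card (?U \<inter> ?V)"
      by (rule card_mono) (use fUV in auto)
    then have "card (?U \<inter> ?V) \<ge> card (P \<inter> Q)"
      using hallB[of "P \<inter> Q"] P by simp
    moreover have "card ?U + card ?V = card (?U \<union> ?V) + card (?U \<inter> ?V)"
      by (rule card_Un_Int[OF fUV])
    moreover have "card P + card Q = card (P \<union> Q) + card (P \<inter> Q)"
      by (rule card_Un_Int[OF P(1) Q(1)])
    ultimately show False using P(3) Q(3) by linarith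
  qed
  have ne: "B D i \<noteq> {}" for i
    using hallB[of "{i}"] by auto
  define f where "f i = (SOME x. x \<in> B D i)" for i
  have f: "f i \<in> B D i" for i unfolding f_def using ne[of i] by (simp add: some_in_eq)
  have sing: "B D i = {f i}" for i using f uniq by blast
  have "inj f"
  proof (rule injI)
    fix i j assume "f i = f j"
    then show "i = j"
      using hallB[of "{i, j}"] sing[of i] sing[of j] by (cases "i = j") auto
  qed
  moreover have "f i \<in> A i" for i using f[of i] by (simp add: B_def)
  ultimately show ?thesis by blast
qed

lemma expanding_set_power:
  fixes K :: "'g::monoid_add set" and c :: real
  assumes "finite K" and exp: "\<And>F. finite F \<Longrightarrow> c * card F \<le> card (F + K)" and "0 \<le> c"
  shows "\<exists>L :: 'g set. finite L \<and> (\<forall>F. finite F \<longrightarrow> c ^ n * card F \<le> card (F + L))"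
proof (induction n)
  case 0
  have "F + {0} = F" for F :: "'g set" by (auto simp: set_plus_def)
  then show ?case by (intro exI[of _ "{0 :: 'g}"]) auto
next
  case (Suc n)
  then obtain L :: "'g set" where L: "finite L" "\<And>F. finite F \<Longrightarrow> c ^ n * card F \<le> card (F + L)"
    by metis
  have "c ^ Suc n * card F \<le> card (F + (L + K))" if F: "finite F" for F
  proof -
    have "c ^ Suc n * card F = c * (c ^ n * card F)" by simp
    also have "\<dots> \<le> c * card (F + L)" using L(2)[OF F] \<open>0 \<le> c\<close> by (rule mult_left_mono)
    also have "\<dots> \<le> card ((F + L) + K)" using F L(1) by (intro exp finite_set_plus)
    finally show ?thesis by (simp add: add.assoc)
  qed
  then show ?case using L(1) assms(1) by (intro exI[of _ "L + K"]) (auto intro: finite_set_plus)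
qed

text \<open>
  Iterating the expansion makes the factor exceed 2.  Then Hall's condition holds for the relation
  that joins both \<open>(x, True)\<close> and \<open>(x, False)\<close> to every \<open>- l + x\<close> with \<open>l \<in> L\<close>, so that the group can be
  mapped two-to-one into itself with bounded displacement.  Inverting turns the expansion under
  addition from the right into displacements from the left, as needed for left-invariant measures.
\<close>

lemma expanding_imp_paradox:
  fixes K :: "'g::group_add set" and c :: real
  assumes "1 < c" and K: "finite K"
    and no: "\<And>F. finite F \<Longrightarrow> F \<noteq> {} \<Longrightarrow> c * card F < card (F + K)"
  obtains L and f :: "'g \<times> bool \<Rightarrow> 'g" where "finite L" "inj f" "\<And>p. f p - fst p \<in> L"
proof -
  have "c * card F \<le> card (F + K)" if "finite F" for F
  proof (cases "F = {}")
    case False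
    then show ?thesis by (rule less_imp_le[OF no[OF that]])
  next
    case True
    then have "c * card F = 0" by (simp only: card.empty of_nat_0 mult_zero_right)
    then show ?thesis by linarith
  qed
  then have pow: "\<exists>L :: 'g set. finite L \<and> (\<forall>F. finite F \<longrightarrow> c ^ n * card F \<le> card (F + L))" for n
    using \<open>1 < c\<close> by (intro expanding_set_power[OF K]) auto
  obtain n where n: "2 < c ^ n" using real_arch_pow[OF assms(1)] by blast
  obtain L :: "'g set" where L: "finite L" "\<And>F. finite F \<Longrightarrow> c ^ n * card F \<le> card (F + L)"
    using pow[of n] by metis
  have double: "2 * card F \<le> card (F + L)" if "finite F" for F
  proof -
    have "2 * real (card F) \<le> c ^ n * card F" using n by (intro mult_right_mono) auto
    also have "\<dots> \<le> card (F + L)" using L(2)[OF that] .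
    finally show ?thesis by linarith
  qed
  define A :: "'g \<times> bool \<Rightarrow> 'g set" where "A p = (\<lambda>l. - l + fst p) ` L" for p
  have "\<exists>f. inj f \<and> (\<forall>p. f p \<in> A p)"
  proof (rule hall_marriage)
    show "finite (A p)" for p using L(1) by (simp add: A_def)
    fix J :: "('g \<times> bool) set" assume J: "finite J"
    let ?F = "uminus ` fst ` J"
    have F: "card ?F = card (fst ` J)" by (intro card_image injI) simp
    have A': "A p = uminus ` (+) (- fst p) ` L" for p
      by (simp add: A_def image_image minus_add)
    have "?F + L = (\<Union>p\<in>J. (+) (- fst p) ` L)"
      by (auto simp: set_plus_def)
    then have un: "(\<Union>p\<in>J. A p) = uminus ` (?F + L)"
      by (simp only: A' image_UN)
    have "J \<subseteq> fst ` J \<times> UNIV" by force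
    then have "card J \<le> card (fst ` J \<times> (UNIV :: bool set))"
      using J by (intro card_mono) auto
    also have "\<dots> = 2 * card ?F"
      by (simp only: F) (simp add: card_cartesian_product)
    also have "\<dots> \<le> card (?F + L)" using J by (intro double) auto
    also have "\<dots> = card (\<Union>p\<in>J. A p)" by (simp add: un card_image)
    finally show "card J \<le> card (\<Union>p\<in>J. A p)" .
  qed
  then obtain f where f: "inj f" "\<forall>p. f p \<in> A p" by (elim exE conjE)
  have "f p - fst p \<in> uminus ` L" for p
  proof -
    obtain l where l: "l \<in> L" "f p = - l + fst p"
      using f(2)[rule_format, of p] unfolding A_def by (elim imageE)
    have "f p - fst p = - l" unfolding l(2) by (rule add_diff_cancel)
    then show ?thesis using l(1) by (simp only: imageI)
  qed
  then show thesis by (rule that[OF finite_imageI[OF L(1)] f(1)])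
qed

text \<open>
  The measure of \<open>G\<close> is pushed forward along the equivariant map \<open>c\<close>.  Cutting two copies of the group
  \<open>'g\<close> into the pieces on which \<open>f\<close> is a fixed translation, and translating the pieces, would give
  disjoint sets of total measure 2.
\<close>

lemma not_amenable_if_paradox:
  fixes f :: "'g::group_add \<times> bool \<Rightarrow> 'g" and G (structure) and c :: "'a \<Rightarrow> 'g"
  assumes K: "finite K" and "inj f" and fK: "\<And>p. f p - fst p \<in> K"
    and "group G" and h: "\<And>g. h g \<in> carrier G"
    and c: "\<And>g x. x \<in> carrier G \<Longrightarrow> c (h g \<otimes> x) = g + c x"
  shows "\<not> amenable G"
proof
  interpret group G by fact
  assume "amenable G"
  then obtain \<mu> :: "_ \<Rightarrow> real" where
    nonneg: "\<forall>A. A \<subseteq> carrier G \<longrightarrow> 0 \<le> \<mu> A" and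
    add: "\<forall>A B. A \<subseteq> carrier G \<longrightarrow> B \<subseteq> carrier G \<longrightarrow> A \<inter> B = {} \<longrightarrow> \<mu> (A \<union> B) = \<mu> A + \<mu> B" and
    inv: "\<forall>g\<in>carrier G. \<forall>A. A \<subseteq> carrier G \<longrightarrow> \<mu> (g <# A) = \<mu> A" and
    total: "\<mu> (carrier G) = 1"
    unfolding amenable_def by (elim exE conjE)
  define \<nu> where "\<nu> A = \<mu> {x \<in> carrier G. c x \<in> A}" for A
  have \<nu>_nonneg: "0 \<le> \<nu> A" for A unfolding \<nu>_def by (rule nonneg[rule_format]) auto
  have \<nu>_add: "\<nu> (A \<union> B) = \<nu> A + \<nu> B" if "A \<inter> B = {}" for A B
  proof -
    have "{x \<in> carrier G. c x \<in> A \<union> B} = {x \<in> carrier G. c x \<in> A} \<union> {x \<in> carrier G. c x \<in> B}" by auto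
    then show ?thesis unfolding \<nu>_def using that by (simp add: add[rule_format, symmetric] disjoint_iff)
  qed
  have \<nu>_sum: "\<nu> (\<Union>i\<in>I. A i) = (\<Sum>i\<in>I. \<nu> (A i))" if "finite I" "disjoint_family_on A I"
    for I and A :: "'i \<Rightarrow> _"
    using that
  proof (induction I)
    case empty
    have "\<nu> ({} \<union> {}) = \<nu> {} + \<nu> {}" by (rule \<nu>_add) auto
    then show ?case by simp
  next
    case (insert i I)
    then have "A i \<inter> (\<Union>j\<in>I. A j) = {}" by (fastforce simp: disjoint_family_on_def)
    with insert show ?case by (simp add: \<nu>_add disjoint_family_on_def)
  qed
  have \<nu>_inv: "\<nu> ((+) g ` A) = \<nu> A" for g A
  proof -
    have "x \<in> h g <# {y \<in> carrier G. c y \<in> A}" if "x \<in> carrier G" "c x \<in> (+) g ` A" for x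
    proof -
      let ?y = "inv h g \<otimes> x"
      have x: "x = h g \<otimes> ?y" "?y \<in> carrier G"
        using h[of g] that(1) by (simp_all add: m_assoc[symmetric])
      then have "g + c ?y \<in> (+) g ` A" using that(2) c[OF x(2), of g] by simp
      then have "c ?y \<in> A" by (auto simp only: image_iff add_left_cancel)
      then show ?thesis using x by (auto simp: l_coset_def)
    qed
    then have "{x \<in> carrier G. c x \<in> (+) g ` A} = h g <# {x \<in> carrier G. c x \<in> A}"
      using h[of g] c by (auto simp: l_coset_def)
    then show ?thesis unfolding \<nu>_def using h[of g] by (simp add: inv[rule_format])
  qed
  have \<nu>_UNIV: "\<nu> UNIV = 1" using total by (simp add: \<nu>_def)
  define A where "A k b = {x. f (x, b) - x = k}" for k b
  have cover: "(\<Sum>k\<in>K. \<nu> (A k b)) = 1" for b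
  proof -
    have "(\<Union>k\<in>K. A k b) = UNIV" using fK[of "(_, b)"] by (auto simp: A_def)
    moreover have "disjoint_family_on (\<lambda>k. A k b) K" by (auto simp: disjoint_family_on_def A_def)
    ultimately show ?thesis using \<nu>_sum[OF K, of "\<lambda>k. A k b"] \<nu>_UNIV by simp
  qed
  have fA: "k + x = f (x, b)" if "x \<in> A k b" for k b x
    using that by (auto simp: A_def)
  let ?E = "\<lambda>(k, b). (+) k ` A k b"
  have "disjoint_family_on ?E (K \<times> UNIV)"
    unfolding disjoint_family_on_def
  proof (intro ballI impI, rule ccontr)
    fix p q :: "_ \<times> bool" assume "p \<noteq> q" "?E p \<inter> ?E q \<noteq> {}"
    then obtain x y where xy: "x \<in> A (fst p) (snd p)" "y \<in> A (fst q) (snd q)" "fst p + x = fst q + y"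
      by (auto simp: case_prod_unfold)
    then have "(x, snd p) = (y, snd q)" using fA \<open>inj f\<close> by (metis injD)
    then show False using xy \<open>p \<noteq> q\<close> by (auto simp: A_def prod_eq_iff)
  qed
  then have "\<nu> (\<Union>p\<in>K \<times> UNIV. ?E p) = (\<Sum>p\<in>K \<times> UNIV. \<nu> (?E p))"
    using K by (intro \<nu>_sum) auto
  also have "\<dots> = (\<Sum>(k, b)\<in>K \<times> UNIV. \<nu> (A k b))"
    by (intro sum.cong) (auto simp: \<nu>_inv)
  also have "\<dots> = (\<Sum>k\<in>K. \<Sum>b\<in>UNIV. \<nu> (A k b))" by (rule sum.cartesian_product[symmetric])
  also have "\<dots> = 2" by (simp add: UNIV_bool sum.distrib cover)
  finally have "\<nu> (\<Union>p\<in>K \<times> UNIV. ?E p) = 2" .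
  moreover have "\<nu> (E \<union> - E) = \<nu> E + \<nu> (- E)" for E by (rule \<nu>_add) auto
  then have le: "\<nu> E \<le> 1" for E using \<nu>_UNIV \<nu>_nonneg[of "- E"] by (metis Compl_partition add_increasing2 dual_order.refl)
  ultimately show False using le[of "\<Union>p\<in>K \<times> UNIV. ?E p"] by simp
qed

section \<open>Spaces of functions over the field with two elements\<close>

text \<open>
  Addition of bits is used as a group operation; rewriting it to exclusive or would defeat the
  simplification rules for groups.
\<close>

declare add_bit_eq_xor [simp del] mult_bit_eq_and [simp del]

lemma bit_add_self [simp]: "a + a = (0 :: bit)"
  by (cases a) auto

text \<open>
  Linear subspaces; over this field closure under addition suffices.  The dimension of the restriction
  of \<open>V\<close> to \<open>A\<close> enters as the cardinality of \<open>traces V A\<close>.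
\<close>

definition bit_space :: "('e \<Rightarrow> bit) set \<Rightarrow> bool" where
  "bit_space V \<longleftrightarrow> (\<lambda>_. 0) \<in> V \<and> (\<forall>\<phi>\<in>V. \<forall>\<psi>\<in>V. (\<lambda>e. \<phi> e + \<psi> e) \<in> V)"

definition restr :: "'e set \<Rightarrow> ('e \<Rightarrow> bit) \<Rightarrow> 'e \<Rightarrow> bit" where
  "restr A \<phi> = (\<lambda>e. if e \<in> A then \<phi> e else 0)"

definition traces :: "('e \<Rightarrow> bit) set \<Rightarrow> 'e set \<Rightarrow> ('e \<Rightarrow> bit) set" where
  "traces V A = restr A ` V"

text \<open>
  Adding \<open>e\<close> to \<open>A\<close> increases the dimension of the restriction exactly if the value at \<open>e\<close> is not determined
  by the values on \<open>A\<close>.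
\<close>

definition free_at :: "('e \<Rightarrow> bit) set \<Rightarrow> 'e set \<Rightarrow> 'e \<Rightarrow> bool" where
  "free_at V A e \<longleftrightarrow> (\<exists>\<phi>\<in>V. (\<forall>x\<in>A. \<phi> x = 0) \<and> \<phi> e = 1)"

lemma restr_eq_iff: "restr A \<phi> = restr A \<psi> \<longleftrightarrow> (\<forall>x\<in>A. \<phi> x = \<psi> x)"
  by (auto simp: restr_def fun_eq_iff)

lemma restr_restr: "restr A (restr B \<phi>) = restr (B \<inter> A) \<phi>"
  by (auto simp: restr_def fun_eq_iff)

lemma supported_eq_image_Pow: "{\<phi> :: 'e \<Rightarrow> bit. \<forall>x. x \<notin> A \<longrightarrow> \<phi> x = 0} = (\<lambda>B x. of_bool (x \<in> B)) ` Pow A"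
proof -
  have "\<phi> \<in> (\<lambda>B x. of_bool (x \<in> B)) ` Pow A" if "\<forall>x. x \<notin> A \<longrightarrow> \<phi> x = 0" for \<phi> :: "'e \<Rightarrow> bit"
  proof (rule image_eqI[of _ _ "{x. \<phi> x = 1}"])
    have "\<phi> x = of_bool (\<phi> x = 1)" for x by (cases "\<phi> x") auto
    then show "\<phi> = (\<lambda>x. of_bool (x \<in> {x. \<phi> x = 1}))" by auto
    show "{x. \<phi> x = 1} \<in> Pow A" using that by force
  qed
  then show ?thesis by (auto simp: of_bool_def)
qed

lemma finite_supported: "finite A \<Longrightarrow> finite {\<phi> :: 'e \<Rightarrow> bit. \<forall>x. x \<notin> A \<longrightarrow> \<phi> x = 0}"
  by (simp add: supported_eq_image_Pow)

lemma card_supported: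
  assumes "finite A"
  shows "card {\<phi> :: 'e \<Rightarrow> bit. \<forall>x. x \<notin> A \<longrightarrow> \<phi> x = 0} = 2 ^ card A"
proof -
  have "inj_on (\<lambda>B x. of_bool (x \<in> B) :: bit) (Pow A)"
    by (auto simp: inj_on_def fun_eq_iff of_bool_def split: if_splits)
  then show ?thesis using assms by (simp add: supported_eq_image_Pow card_image card_Pow)
qed

lemma finite_traces: "finite A \<Longrightarrow> finite (traces V A)"
  by (rule finite_subset[OF _ finite_supported[of A]]) (auto simp: traces_def restr_def)

lemma traces_antimono_restr: "A \<subseteq> B \<Longrightarrow> traces V A = restr A ` traces V B"
  by (simp add: traces_def image_image restr_restr Int_absorb1)

lemma card_traces_mono: "finite B \<Longrightarrow> A \<subseteq> B \<Longrightarrow> card (traces V A) \<le> card (traces V B)"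
  by (simp add: traces_antimono_restr card_image_le finite_traces)

lemma card_traces_insert:
  assumes V: "bit_space V" and A: "finite A" "e \<notin> A"
  shows "card (traces V (insert e A)) = (if free_at V A e then 2 else 1) * card (traces V A)"
proof (cases "free_at V A e")
  case False
  have "inj_on (restr A) (traces V (insert e A))"
  proof (rule inj_onI)
    fix t u assume "t \<in> traces V (insert e A)" "u \<in> traces V (insert e A)" and eq: "restr A t = restr A u"
    then obtain \<phi> \<psi> where *: "\<phi> \<in> V" "\<psi> \<in> V" "t = restr (insert e A) \<phi>" "u = restr (insert e A) \<psi>"
      by (auto simp: traces_def)
    have agree: "\<forall>x\<in>A. \<phi> x = \<psi> x" using eq A(2) by (auto simp: * restr_restr restr_eq_iff insert_absorb Int_insert_left)
    have "(\<lambda>x. \<phi> x + \<psi> x) \<in> V" using V * by (auto simp: bit_space_def)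
    then have "\<phi> e + \<psi> e \<noteq> 1" using False agree unfolding free_at_def by force
    then have "\<phi> e = \<psi> e" by (cases "\<phi> e"; cases "\<psi> e") auto
    then show "t = u" using agree by (simp add: * restr_eq_iff)
  qed
  then show ?thesis using False by (subst traces_antimono_restr[of A "insert e A"]) (auto simp: card_image)
next
  case True
  then obtain \<xi> where \<xi>: "\<xi> \<in> V" "\<forall>x\<in>A. \<xi> x = 0" "\<xi> e = 1" by (auto simp: free_at_def)
  let ?f = "\<lambda>t. (restr A t, t e)"
  have "bij_betw ?f (traces V (insert e A)) (traces V A \<times> UNIV)"
  proof (rule bij_betwI')
    fix t u assume "t \<in> traces V (insert e A)" "u \<in> traces V (insert e A)"
    then obtain \<phi> \<psi> where *: "t = restr (insert e A) \<phi>" "u = restr (insert e A) \<psi>"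
      by (auto simp: traces_def)
    show "(?f t = ?f u) = (t = u)"
      by (simp add: * restr_restr restr_eq_iff Int_insert_left A(2)) (auto simp: restr_def)
  next
    fix t assume "t \<in> traces V (insert e A)"
    then show "?f t \<in> traces V A \<times> UNIV" using traces_antimono_restr[of A "insert e A" V] by auto
  next
    fix p :: "('a \<Rightarrow> bit) \<times> bit" assume "p \<in> traces V A \<times> UNIV"
    then obtain \<phi> b where p: "p = (restr A \<phi>, b)" "\<phi> \<in> V" by (auto simp: traces_def)
    define \<psi> where "\<psi> = (if \<phi> e = b then \<phi> else (\<lambda>x. \<phi> x + \<xi> x))"
    have "\<psi> \<in> V" using V p(2) \<xi>(1) by (auto simp: \<psi>_def bit_space_def)
    moreover have "\<psi> e = b" using \<xi>(3) by (cases "\<phi> e"; cases b) (auto simp: \<psi>_def)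
    moreover have "\<forall>x\<in>A. \<psi> x = \<phi> x" using \<xi>(2) by (auto simp: \<psi>_def)
    then have "restr A (restr (insert e A) \<psi>) = restr A \<phi>" "restr (insert e A) \<psi> e = \<psi> e"
      by (auto simp: restr_def fun_eq_iff)
    ultimately show "\<exists>t\<in>traces V (insert e A). p = ?f t"
      by (intro bexI[of _ "restr (insert e A) \<psi>"])
         (auto simp: p traces_def)
  qed
  moreover have "(UNIV :: bit set) = {0, 1}" using bit_not_zero_iff by blast
  moreover have "card {0, 1 :: bit} = 2" by (simp add: card_insert_if)
  ultimately show ?thesis
    using True by (simp add: bij_betw_same_card card_cartesian_product)
qed

lemma free_at_antimono: "A \<subseteq> B \<Longrightarrow> free_at V B e \<Longrightarrow> free_at V A e"
  by (auto simp: free_at_def)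

text \<open>
  Shearer's inequality, for dimensions in place of entropies.  Build up \<open>A\<close> point by point.  A point \<open>e\<close>
  that raises the dimension over the previous points does so, by \<open>free_at_antimono\<close>, also over
  their intersection with each of the at least \<open>k\<close> sets \<open>B i\<close> containing \<open>e\<close>.
\<close>

lemma shearer_traces:
  assumes V: "bit_space V" and "finite A" "finite I"
    and "\<And>e. e \<in> A \<Longrightarrow> k \<le> card {i \<in> I. e \<in> B i}"
  shows "card (traces V A) ^ k \<le> (\<Prod>i\<in>I. card (traces V (B i \<inter> A)))"
  using assms(2,4)
proof (induction A)
  case empty
  have "traces V {} = {\<lambda>_. 0}" using V by (force simp: traces_def restr_def bit_space_def)
  then show ?case by simp
next
  case (insert e A)
  have IH: "card (traces V A) ^ k \<le> (\<Prod>i\<in>I. card (traces V (B i \<inter> A)))"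
    using insert by simp
  show ?case
  proof (cases "free_at V A e")
    case False
    then have "card (traces V (insert e A)) ^ k = card (traces V A) ^ k"
      using card_traces_insert[OF V insert(1,2)] by simp
    also note IH
    also have "(\<Prod>i\<in>I. card (traces V (B i \<inter> A))) \<le> (\<Prod>i\<in>I. card (traces V (B i \<inter> insert e A)))"
      using insert(1) by (intro prod_mono conjI card_traces_mono) auto
    finally show ?thesis .
  next
    case True
    have "card (traces V (insert e A)) ^ k = 2 ^ k * card (traces V A) ^ k"
      using card_traces_insert[OF V insert(1,2)] True by (simp add: power_mult_distrib)
    also have "\<dots> \<le> 2 ^ card {i \<in> I. e \<in> B i} * (\<Prod>i\<in>I. card (traces V (B i \<inter> A)))"
      using insert.prems[of e] IH by (intro mult_mono power_increasing) auto
    also have "(2::nat) ^ card {i \<in> I. e \<in> B i} = (\<Prod>i\<in>I. if e \<in> B i then 2 else 1)"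
      using \<open>finite I\<close> by (simp add: prod.If_cases Int_def)
    also have "\<dots> * (\<Prod>i\<in>I. card (traces V (B i \<inter> A))) =
        (\<Prod>i\<in>I. (if e \<in> B i then 2 else 1) * card (traces V (B i \<inter> A)))"
      by (rule prod.distrib[symmetric])
    also have "\<dots> = (\<Prod>i\<in>I. card (traces V (B i \<inter> insert e A)))"
    proof (rule prod.cong)
      fix i
      show "(if e \<in> B i then 2 else 1) * card (traces V (B i \<inter> A)) = card (traces V (B i \<inter> insert e A))"
        using card_traces_insert[OF V, of "B i \<inter> A" e] insert(1,2) True
          free_at_antimono[of "B i \<inter> A" A V e]
        by (auto simp: Int_insert_right)
    qed simp
    finally show ?thesis .
  qed
qed

text \<open>
  Each linear condition cuts the dimension by at most one.
\<close>

lemma card_le_kernels: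
  assumes "finite J"
    and "bit_space W" "finite W"
    and "\<And>j \<phi> \<psi>. j \<in> J \<Longrightarrow> c j (\<lambda>e. \<phi> e + \<psi> e) = c j \<phi> + (c j \<psi> :: bit)"
    and "\<And>j. j \<in> J \<Longrightarrow> c j (\<lambda>_. 0) = 0"
  shows "card W \<le> 2 ^ card J * card {\<phi> \<in> W. \<forall>j\<in>J. c j \<phi> = 0}"
  using assms
proof (induction J arbitrary: W)
  case empty
  then show ?case by simp
next
  case (insert j J)
  let ?W0 = "{\<phi> \<in> W. c j \<phi> = 0}" and ?W1 = "{\<phi> \<in> W. c j \<phi> = 1}"
  have W: "W = ?W0 \<union> ?W1" using bit_not_zero_iff by blast
  have "card ?W1 \<le> card ?W0"
  proof (cases "?W1 = {}")
    case False
    then obtain \<xi> where \<xi>: "\<xi> \<in> W" "c j \<xi> = 1" by blast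
    show ?thesis
    proof (rule card_inj_on_le[of "\<lambda>\<phi> e. \<phi> e + \<xi> e"])
      show "inj_on (\<lambda>\<phi> e. \<phi> e + \<xi> e) ?W1" by (auto simp: inj_on_def fun_eq_iff)
      show "(\<lambda>\<phi> e. \<phi> e + \<xi> e) ` ?W1 \<subseteq> ?W0"
        using \<xi> insert.prems by (auto simp: bit_space_def)
      show "finite ?W0" using insert.prems by simp
    qed
  next
    case True
    show ?thesis unfolding True by simp
  qed
  moreover have "card W \<le> card ?W0 + card ?W1" by (subst W) (rule card_Un_le)
  moreover have "bit_space ?W0" using insert.prems by (auto simp: bit_space_def)
  then have "card ?W0 \<le> 2 ^ card J * card {\<phi> \<in> ?W0. \<forall>j\<in>J. c j \<phi> = 0}"
    using insert.prems by (intro insert.IH) auto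
  moreover have "{\<phi> \<in> ?W0. \<forall>j\<in>J. c j \<phi> = 0} = {\<phi> \<in> W. \<forall>j\<in>insert j J. c j \<phi> = 0}" by auto
  ultimately show ?case using insert(1,2) by simp
qed

definition wpow :: "nat \<Rightarrow> 'a list \<Rightarrow> 'a list" where
  "wpow n w = concat (replicate n w)"

lemma wpow_simps [simp]: "wpow 0 w = []" "wpow (Suc n) w = w @ wpow n w"
  by (simp_all add: wpow_def)

lemma wpow_add: "wpow (m + n) w = wpow m w @ wpow n w"
  by (simp add: wpow_def replicate_add)

section \<open>A two-generator torsion group with sparse relators\<close>

text \<open>
  Any powers of 2 whose reciprocals sum to less than \<open>2 - 1\<close>, the number of generators minus one, would
  do for the count in \<open>torsion_expanding\<close>; with \<open>1/2\<close> there is room for the boundary terms.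
\<close>

definition exponent :: "bool list \<Rightarrow> nat" where
  "exponent s = 2 ^ (to_nat s + 2)"

definition relator :: "bool list \<Rightarrow> bool list" where
  "relator s = wpow (exponent s) s"

lemma exponent_pos: "0 < exponent s"
  by (simp add: exponent_def)

lemma sum_inverse_exponents:
  assumes "finite R"
  shows "(\<Sum>s\<in>R. 1 / real (exponent s)) \<le> 1 / 2"
proof -
  obtain m where m: "to_nat ` R \<subseteq> {..<m}"
    using finite_nat_set_iff_bounded[of "to_nat ` R"] assms by auto
  have "(\<Sum>s\<in>R. 1 / real (exponent s)) = (\<Sum>n\<in>to_nat ` R. (1 / 2) ^ (n + 2))"
    by (subst sum.reindex) (auto simp: exponent_def power_one_over intro: inj_on_subset[OF inj_to_nat])
  also have "\<dots> \<le> (\<Sum>n<m. (1 / 2 :: real) ^ (n + 2))"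
    using m by (intro sum_mono2) auto
  also have "\<dots> = (\<Sum>n<m. (1 / 2 :: real) ^ n) / 4"
    by (simp add: power_add sum_divide_distrib)
  also have "(\<Sum>n<m. (1 / 2 :: real) ^ n) \<le> 2"
    by (subst sum_gp_strict) (simp add: field_simps)
  finally show ?thesis by simp
qed

text \<open>
  Since every positive word gets a relator, inverses of the generators are positive words, and the group
  can be presented as a monoid.  The set \<open>R\<close> of words whose relators may be used is a parameter because
  a single equality of words needs only finitely many relators.
\<close>

inductive word_eq :: "bool list set \<Rightarrow> bool list \<Rightarrow> bool list \<Rightarrow> bool" for R where
  relator: "s \<in> R \<Longrightarrow> word_eq R (u @ relator s @ v) (u @ v)"
| refl: "word_eq R u u"
| sym: "word_eq R u v \<Longrightarrow> word_eq R v u"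
| trans: "word_eq R u v \<Longrightarrow> word_eq R v w \<Longrightarrow> word_eq R u w"

lemma word_eq_mono: "word_eq R u v \<Longrightarrow> R \<subseteq> R' \<Longrightarrow> word_eq R' u v"
  by (induction rule: word_eq.induct) (auto intro: word_eq.intros)

lemma word_eq_context: "word_eq R u v \<Longrightarrow> word_eq R (x @ u @ y) (x @ v @ y)"
proof (induction rule: word_eq.induct)
  case (relator s u v)
  then show ?case using word_eq.relator[of s R "x @ u" "v @ y"] by simp
qed (auto intro: word_eq.intros)

lemma word_eq_append: "word_eq R u v \<Longrightarrow> word_eq R u' v' \<Longrightarrow> word_eq R (u @ u') (v @ v')"
  by (rule word_eq.trans[of _ _ "v @ u'"])
    (use word_eq_context[of R u v "[]" u'] word_eq_context[of R u' v' v "[]"] in simp_all)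

lemma word_eq_finite: "word_eq R u v \<Longrightarrow> \<exists>R0. finite R0 \<and> word_eq R0 u v"
proof (induction rule: word_eq.induct)
  case (relator s u v)
  then show ?case by (intro exI[of _ "{s}"]) (auto intro: word_eq.relator)
next
  case (trans u v w)
  then obtain R1 R2 where "finite R1" "word_eq R1 u v" "finite R2" "word_eq R2 v w" by blast
  then show ?case
    by (intro exI[of _ "R1 \<union> R2"]) (auto intro: word_eq.trans word_eq_mono)
qed (auto intro: word_eq.intros)

quotient_type torsion = "bool list" / "word_eq UNIV"
  by (intro equivpI reflpI sympI transpI) (blast intro: word_eq.intros)+

lift_definition elem :: "bool list \<Rightarrow> torsion" is "\<lambda>w. w" .

lemma elem_eq_iff: "elem u = elem v \<longleftrightarrow> word_eq UNIV u v"
  by transfer simp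

lemma elem_surj: "\<exists>w. elem w = g"
  by transfer (auto intro: word_eq.refl)

instantiation torsion :: group_add
begin

lift_definition zero_torsion :: torsion is "[]" .

lift_definition plus_torsion :: "torsion \<Rightarrow> torsion \<Rightarrow> torsion" is "(@)"
  by (rule word_eq_append)

definition uminus_torsion :: "torsion \<Rightarrow> torsion" where
  "- g = (SOME h. h + g = 0)" for g :: torsion

definition minus_torsion :: "torsion \<Rightarrow> torsion \<Rightarrow> torsion" where
  "g - h = g + - h" for g h :: torsion

instance
proof
  fix a b c :: torsion
  show "a + b + c = a + (b + c)" by transfer (simp add: word_eq.refl)
  show "0 + a = a" "a + 0 = a" by (transfer, simp add: word_eq.refl)+
  have "\<exists>h. h + a = 0"
  proof transfer
    fix w
    have "wpow (exponent w - 1) w @ w = wpow (exponent w - 1 + 1) w"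
      by (simp only: wpow_add) simp
    then have "wpow (exponent w - 1) w @ w = [] @ relator w @ []"
      using exponent_pos[of w] by (simp add: relator_def)
    then have "word_eq UNIV (wpow (exponent w - 1) w @ w) ([] @ [])"
      by (simp only: word_eq.relator UNIV_I)
    then show "\<exists>h. word_eq UNIV (h @ w) []" by auto
  qed
  then show "- a + a = 0" unfolding uminus_torsion_def by (rule someI_ex)
  show "a + - b = a - b" by (simp add: minus_torsion_def)
qed

end

lemma elem_Nil [simp]: "elem [] = 0"
  by transfer (rule word_eq.refl)

lemma elem_append [simp]: "elem (u @ v) = elem u + elem v"
  by transfer (rule word_eq.refl)

lemma elem_Cons: "elem (b # w) = elem [b] + elem w"
  using elem_append[of "[b]" w] by simp

lemma elem_relator [simp]: "elem (relator s) = 0"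
  using elem_eq_iff[of "[] @ relator s @ []" "[] @ []"] word_eq.relator[of s UNIV "[]" "[]"] by simp

definition nmul :: "nat \<Rightarrow> 'a::monoid_add \<Rightarrow> 'a" where
  "nmul n a = sum_list (replicate n a)"

lemma nmul_simps [simp]: "nmul 0 a = 0" "nmul (Suc n) a = a + nmul n a"
  by (simp_all add: nmul_def)

lemma nmul_add: "nmul (m + n) a = nmul m a + nmul n a"
  by (simp add: nmul_def replicate_add)

lemma nmul_zero: "nmul n 0 = 0"
  by (induction n) simp_all

lemma nmul_mult_eq_0: "nmul m a = 0 \<Longrightarrow> nmul (m * k) a = 0"
  by (induction k) (simp_all add: nmul_add)

lemma elem_wpow: "elem (wpow n w) = nmul n (elem w)"
  by (induction n) simp_all

lemma torsion_exponent: "\<exists>n>0. nmul n (g :: torsion) = 0"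
  using elem_surj[of g] exponent_pos elem_relator unfolding relator_def elem_wpow by metis

definition multiples :: "'a::monoid_add \<Rightarrow> 'a set" where
  "multiples a = range (\<lambda>i. nmul i a)"

lemma multiples_props:
  fixes a :: "'g::group_add"
  assumes "0 < n" "nmul n a = 0"
  shows "multiples a = (\<lambda>i. nmul i a) ` {..<n}"
    and "x \<in> multiples a \<Longrightarrow> y \<in> multiples a \<Longrightarrow> x + y \<in> multiples a"
    and "x \<in> multiples a \<Longrightarrow> - x \<in> multiples a"
proof -
  have mod: "nmul i a = nmul (i mod n) a" for i
    using nmul_add[of "n * (i div n)" "i mod n" a] nmul_mult_eq_0[OF assms(2)] by simp
  show "multiples a = (\<lambda>i. nmul i a) ` {..<n}"
  proof
    show "multiples a \<subseteq> (\<lambda>i. nmul i a) ` {..<n}"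
      using mod \<open>0 < n\<close> by (force simp: multiples_def)
  qed (auto simp: multiples_def)
  show "x + y \<in> multiples a" if "x \<in> multiples a" "y \<in> multiples a"
    using that by (auto simp: multiples_def nmul_add[symmetric])
  show "- x \<in> multiples a" if x: "x \<in> multiples a"
  proof -
    obtain i where i: "x = nmul i a" using x by (auto simp: multiples_def)
    have "i + (n * i - i) = n * i" using \<open>0 < n\<close> by (cases n) auto
    then have "nmul i a + nmul (n * i - i) a = 0"
      using nmul_mult_eq_0[OF assms(2), of i] by (simp add: nmul_add[symmetric])
    then have "- x = nmul (n * i - i) a" by (simp add: i minus_unique)
    then show ?thesis by (auto simp: multiples_def)
  qed
qed

lemma zero_in_multiples: "0 \<in> multiples a"
  unfolding multiples_def by (rule range_eqI[of _ _ 0]) simp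

lemma in_multiples: "a \<in> multiples a"
  unfolding multiples_def by (rule range_eqI[of _ _ 1]) (simp add: nmul_def)

text \<open>
  The annihilator of \<open>a\<close> is closed under greatest common divisors, and a divisor of \<open>2 ^ Suc k\<close> smaller than
  \<open>2 ^ Suc k\<close> divides \<open>2 ^ k\<close>.  So the order of \<open>a\<close> is the full power of 2 as soon as half of it does not
  annihilate \<open>a\<close>.
\<close>

lemma card_multiples:
  fixes a :: "'g::group_add"
  assumes zero: "nmul (2 ^ Suc k) a = 0" and half: "nmul (2 ^ k) a \<noteq> 0"
  shows "card (multiples a) = 2 ^ Suc k"
proof -
  have no: "nmul d a \<noteq> 0" if d: "0 < d" "d < 2 ^ Suc k" for d
  proof
    assume 0: "nmul d a = 0"
    let ?e = "gcd d (2 ^ Suc k)"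
    obtain x y where "d * x = 2 ^ Suc k * y + ?e" using bezout_nat[of d] d by blast
    then have "nmul (2 ^ Suc k * y) a + nmul ?e a = 0"
      using nmul_mult_eq_0[OF 0, of x] by (simp only: nmul_add)
    then have "nmul ?e a = 0" using nmul_mult_eq_0[OF zero, of y] by simp
    moreover obtain j where j: "j \<le> Suc k" "?e = 2 ^ j"
      using divides_primepow_nat[OF two_is_prime_nat, of ?e "Suc k"] by auto
    moreover have "?e \<le> d" using d by (intro gcd_le1_nat) simp
    then have "(2::nat) ^ j < 2 ^ Suc k" using d(2) j(2) by simp
    then have "j < Suc k" by (rule power_less_imp_less_exp[rotated]) simp
    then have "2 ^ k = (2::nat) ^ j * 2 ^ (k - j)" by (simp add: power_add[symmetric])
    ultimately show False using half nmul_mult_eq_0[of ?e a "2 ^ (k - j)"] by simp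
  qed
  have *: "nmul i a \<noteq> nmul j a" if "i < j" "j < 2 ^ Suc k" for i j
  proof
    assume "nmul i a = nmul j a"
    then have "nmul i a + 0 = nmul i a + nmul (j - i) a"
      using that nmul_add[of i "j - i" a] by simp
    then have "nmul (j - i) a = 0" by (simp only: add_left_cancel)
    moreover have "0 < j - i" "j - i < 2 ^ Suc k" using that by linarith+
    ultimately show False using no by blast
  qed
  have "inj_on (\<lambda>i. nmul i a) {..<2 ^ Suc k}"
  proof (rule inj_onI)
    fix i j :: nat assume "i \<in> {..<2 ^ Suc k}" "j \<in> {..<2 ^ Suc k}" "nmul i a = nmul j a"
    then show "i = j" using *[of i j] *[of j i] by (cases i j rule: linorder_cases) auto
  qed
  then show ?thesis
    using multiples_props(1)[OF _ zero] by (simp add: card_image del: power_Suc)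
qed

section \<open>Expansion by counting closed cochains\<close>

text \<open>
  The edge \<open>(g, b)\<close> of the Cayley graph leads from \<open>g\<close> to \<open>g + elem [b]\<close>, and \<open>path_sum \<phi> g w\<close> sums \<open>\<phi>\<close> along
  the path that starts at \<open>g\<close> and spells \<open>w\<close>.
\<close>

primrec path_sum :: "(torsion \<times> bool \<Rightarrow> bit) \<Rightarrow> torsion \<Rightarrow> bool list \<Rightarrow> bit" where
  "path_sum \<phi> g [] = 0"
| "path_sum \<phi> g (b # w) = \<phi> (g, b) + path_sum \<phi> (g + elem [b]) w"

lemma path_sum_append: "path_sum \<phi> g (u @ v) = path_sum \<phi> g u + path_sum \<phi> (g + elem u) v"
proof (induction u arbitrary: g)
  case (Cons b u)
  then show ?case by (simp add: add.assoc elem_Cons[of b u])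
qed simp

lemma path_sum_add: "path_sum (\<lambda>e. \<phi> e + \<psi> e) g w = path_sum \<phi> g w + path_sum \<psi> g w"
  by (induction w arbitrary: g) (simp_all add: ac_simps)

lemma path_sum_zero [simp]: "path_sum (\<lambda>_. 0) g w = 0"
  by (induction w arbitrary: g) simp_all

lemma path_sum_shift: "path_sum (\<lambda>(x, b). \<phi> (h + x, b)) g w = path_sum \<phi> (h + g) w"
  by (induction w arbitrary: g) (simp_all add: add.assoc)

lemma path_sum_eq_0:
  "(\<And>j. j < length w \<Longrightarrow> \<phi> (g + elem (take j w), w ! j) = 0) \<Longrightarrow> path_sum \<phi> g w = 0"
proof (induction w arbitrary: g)
  case (Cons b w)
  have "\<phi> (g, b) = 0" using Cons.prems[of 0] by simp
  moreover have "\<phi> (g + elem [b] + elem (take j w), w ! j) = 0" if "j < length w" for j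
    using Cons.prems[of "Suc j"] that elem_Cons[of b "take j w"] by (simp add: add.assoc)
  then have "path_sum \<phi> (g + elem [b]) w = 0" by (rule Cons.IH)
  ultimately show ?case by simp
qed simp

text \<open>
  Cochains that are closed on the Cayley complex of the presentation that has only the relators of \<open>R\<close>
  as 2-cells, attached to the Cayley graph of the full group.
\<close>

definition closed_cochains :: "bool list set \<Rightarrow> (torsion \<times> bool \<Rightarrow> bit) set" where
  "closed_cochains R = {\<phi>. \<forall>g. \<forall>s\<in>R. path_sum \<phi> g (relator s) = 0}"

lemma bit_space_closed_cochains: "bit_space (closed_cochains R)"
  by (simp add: bit_space_def closed_cochains_def path_sum_add)

lemma path_sum_word_eq:
  assumes "\<phi> \<in> closed_cochains R"
  shows "word_eq R u v \<Longrightarrow> path_sum \<phi> g u = path_sum \<phi> g v"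
  by (induction rule: word_eq.induct)
    (use assms in \<open>auto simp: path_sum_append closed_cochains_def\<close>)

text \<open>
  Choose a word for every vertex in \<open>F\<close> and its neighbours, and let \<open>R\<close> contain the relators that are needed
  to identify, for every edge starting in \<open>F\<close>, the word of its initial vertex followed by the letter of the
  edge with the word of its terminal vertex.  Then the path sums along the chosen words are a potential
  for every cochain closed under \<open>R\<close>, and such a cochain is determined on \<open>F\<close> by the potential on
  \<open>F\<close> and its neighbours.
\<close>

lemma card_traces_closed_cochains_le:
  assumes F: "finite F"
  shows "\<exists>R. finite R \<and> card (traces (closed_cochains R) (F \<times> UNIV)) \<le> 2 ^ card (F + {0, elem [True], elem [False]})"
proof -
  define U where "U = F + {0, elem [True], elem [False]}"
  have U: "g \<in> U" "g + elem [b] \<in> U" if "g \<in> F" for g b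
    using set_plus_intro[OF that, of 0] set_plus_intro[OF that, of "elem [b]"]
    by (cases b; simp add: U_def)+
  have "finite U" using F by (simp add: U_def finite_set_plus)
  define \<tau> where "\<tau> g = (SOME w. elem w = g)" for g
  have \<tau>: "elem (\<tau> g) = g" for g unfolding \<tau>_def using elem_surj[of g] by (rule someI_ex)
  have "\<exists>R. finite R \<and> word_eq R (\<tau> g @ [b]) (\<tau> (g + elem [b]))" for g b
    by (rule word_eq_finite[of UNIV]) (simp add: elem_eq_iff[symmetric] \<tau>)
  then obtain r where r: "finite (r g b)" "word_eq (r g b) (\<tau> g @ [b]) (\<tau> (g + elem [b]))" for g b
    by metis
  define R where "R = (\<Union>g\<in>F. \<Union>b. r g b)"
  have "finite R" using F r(1) by (auto simp: R_def)
  define grad :: "(torsion \<Rightarrow> bit) \<Rightarrow> torsion \<times> bool \<Rightarrow> bit"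
    where "grad f = (\<lambda>(g, b). f g + f (g + elem [b]))" for f
  let ?S = "{f :: torsion \<Rightarrow> bit. \<forall>x. x \<notin> U \<longrightarrow> f x = 0}"
  have "traces (closed_cochains R) (F \<times> UNIV) \<subseteq> (\<lambda>f. restr (F \<times> UNIV) (grad f)) ` ?S"
    unfolding traces_def
  proof (rule image_subsetI)
    fix \<phi> assume \<phi>: "\<phi> \<in> closed_cochains R"
    define f where "f g = path_sum \<phi> 0 (\<tau> g)" for g
    have "\<phi> (g, b) = f g + f (g + elem [b])" if "g \<in> F" for g b
    proof -
      have "word_eq R (\<tau> g @ [b]) (\<tau> (g + elem [b]))"
        by (rule word_eq_mono[OF r(2)]) (use that in \<open>auto simp: R_def\<close>)
      from path_sum_word_eq[OF \<phi> this, of 0]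
      have "f (g + elem [b]) = f g + \<phi> (g, b)" by (simp add: f_def path_sum_append \<tau>)
      then show ?thesis by (simp add: add.assoc[symmetric])
    qed
    then have "restr (F \<times> UNIV) \<phi> = restr (F \<times> UNIV) (grad (restr U f))"
      using U by (auto simp: restr_eq_iff grad_def restr_def)
    moreover have "restr U f \<in> ?S" by (simp add: restr_def)
    ultimately show "restr (F \<times> UNIV) \<phi> \<in> (\<lambda>f. restr (F \<times> UNIV) (grad f)) ` ?S" by blast
  qed
  then have "card (traces (closed_cochains R) (F \<times> UNIV)) \<le> card ?S"
    using finite_supported[OF \<open>finite U\<close>] by (rule surj_card_le[rotated])
  also have "\<dots> = 2 ^ card U" by (rule card_supported[OF \<open>finite U\<close>])
  finally show ?thesis using \<open>finite R\<close> unfolding U_def by blast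
qed

lemma card_traces_translate:
  "card (traces (closed_cochains R) (((+) g ` F) \<times> UNIV)) = card (traces (closed_cochains R) (F \<times> UNIV))"
proof -
  let ?V = "closed_cochains R"
  define T where "T h \<phi> = (\<lambda>(x, b). \<phi> (h + x, b))" for h and \<phi> :: "torsion \<times> bool \<Rightarrow> bit"
  have T: "T h \<phi> \<in> ?V" if "\<phi> \<in> ?V" for h \<phi>
    using that by (simp add: T_def closed_cochains_def path_sum_shift)
  have TT: "T h (T k \<phi>) = T (k + h) \<phi>" for h k \<phi> by (simp add: T_def add.assoc fun_eq_iff)
  have T0: "T 0 \<phi> = \<phi>" for \<phi> by (simp add: T_def)
  have TV: "T h ` ?V = ?V" for h
  proof
    show "?V \<subseteq> T h ` ?V"
    proof
      fix \<phi> assume "\<phi> \<in> ?V"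
      then have "T (- h) \<phi> \<in> ?V" "\<phi> = T h (T (- h) \<phi>)" by (simp_all add: T TT T0)
      then show "\<phi> \<in> T h ` ?V" by blast
    qed
  qed (use T in blast)
  have rT: "restr (F \<times> UNIV) (T g \<phi>) = T g (restr (((+) g ` F) \<times> UNIV) \<phi>)" for \<phi>
    by (auto simp: T_def restr_def fun_eq_iff image_iff)
  have "traces ?V (F \<times> UNIV) = (\<lambda>\<phi>. restr (F \<times> UNIV) (T g \<phi>)) ` ?V"
    unfolding traces_def by (subst (1) TV[of g, symmetric]) (simp add: image_image)
  also have "\<dots> = T g ` traces ?V (((+) g ` F) \<times> UNIV)"
    unfolding traces_def rT by (simp add: image_image)
  also have "card \<dots> = card (traces ?V (((+) g ` F) \<times> UNIV))"
  proof (rule card_image, rule inj_on_inverseI)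
    show "T (- g) (T g \<phi>) = \<phi>" for \<phi> by (simp add: TT T0)
  qed
  finally show ?thesis by simp
qed

lemma path_sum_wpow_eq_0:
  assumes a: "a = elem s" and a0: "\<And>x. x \<in> T \<Longrightarrow> x - a \<in> T"
    and zero: "\<And>x. x \<notin> T \<Longrightarrow> path_sum \<phi> x s = 0"
  shows "g \<notin> T \<Longrightarrow> path_sum \<phi> g (wpow n s) = 0"
proof (induction n arbitrary: g)
  case (Suc n)
  have "g + a \<notin> T" using a0[of "g + a"] Suc.prems by auto
  then show ?case using zero[OF Suc.prems] Suc.IH by (simp add: path_sum_append a)
qed simp

text \<open>
  Going round the loop of \<open>relator s\<close> from \<open>g\<close> or from \<open>g + elem s\<close> traverses the same edges, because
  \<open>relator s\<close> commutes with \<open>s\<close> as a word and is a closed path.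
\<close>

lemma path_sum_relator_shift:
  "x \<in> multiples (elem s) \<Longrightarrow> path_sum \<phi> (g + x) (relator s) = path_sum \<phi> g (relator s)"
proof -
  have step: "path_sum \<phi> (g + elem s) (relator s) = path_sum \<phi> g (relator s)" for g
  proof -
    have "s @ relator s = relator s @ s"
      using wpow_add[of 1 "exponent s" s] wpow_add[of "exponent s" 1 s]
      by (simp add: relator_def wpow_def)
    then have "path_sum \<phi> g (s @ relator s) = path_sum \<phi> g (relator s @ s)" by simp
    then show ?thesis by (simp add: path_sum_append add.commute)
  qed
  have "path_sum \<phi> (g + nmul i (elem s)) (relator s) = path_sum \<phi> g (relator s)" for i g
    by (induction i arbitrary: g) (simp_all add: step add.assoc[symmetric])
  then show "x \<in> multiples (elem s) \<Longrightarrow> path_sum \<phi> (g + x) (relator s) = path_sum \<phi> g (relator s)"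
    by (auto simp: multiples_def)
qed

text \<open>
  For functions supported on the edges that start in \<open>F\<close>, the condition of \<open>relator s\<close> needs to be checked
  only at a set \<open>J\<close> of about \<open>card F / exponent s\<close> base points.  If half of the exponent already annihilates
  \<open>elem s\<close>, the loop is a closed path run through twice and the condition is void modulo 2.  Otherwise
  \<open>elem s\<close> has order \<open>exponent s\<close>.  The base points of the loops that meet \<open>F\<close> form a union \<open>F + K\<close> of cosets
  of the cyclic group of multiples of \<open>elem s\<close>, and one base point from each coset suffices.
\<close>

lemma relator_conditions:
  "\<exists>K. finite K \<and> (\<forall>F. finite F \<longrightarrow>
     (\<exists>J. finite J \<and> exponent s * card J \<le> card (F + K) \<and>
       (\<forall>\<phi>. (\<forall>e. e \<notin> F \<times> UNIV \<longrightarrow> \<phi> e = 0) \<longrightarrow> (\<forall>g\<in>J. path_sum \<phi> g (relator s) = 0) \<longrightarrow>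
         (\<forall>g. path_sum \<phi> g (relator s) = 0))))"
proof -
  define k where "k = Suc (to_nat s)"
  define a where "a = elem s"
  have N: "exponent s = 2 ^ Suc k" by (simp add: exponent_def k_def)
  have a0: "nmul (2 ^ Suc k) a = 0"
    using elem_relator[of s] unfolding relator_def elem_wpow N a_def .
  show ?thesis
  proof (cases "nmul (2 ^ k) a = 0")
    case True
    have "path_sum \<phi> g (relator s) = 0" for \<phi> g
    proof -
      have "relator s = wpow (2 ^ k) s @ wpow (2 ^ k) s"
        unfolding relator_def N wpow_add[symmetric] by (simp add: mult_2)
      then show ?thesis using True by (simp add: path_sum_append elem_wpow a_def)
    qed
    then show ?thesis by (intro exI[of _ "{}"] conjI allI impI) auto
  next
    case False
    let ?S = "multiples a"
    have S: "finite ?S" "card ?S = exponent s"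
      using multiples_props(1)[OF _ a0] card_multiples[OF a0 False] N by (simp_all del: power_Suc)
    note S_add = multiples_props(2)[OF _ a0, simplified] and S_minus = multiples_props(3)[OF _ a0, simplified]
    define K where "K = (\<lambda>(x, j). - (x + elem (take j s))) ` (?S \<times> {..<length s})"
    have "finite K" using S by (simp add: K_def)
    have "\<exists>J. finite J \<and> exponent s * card J \<le> card (F + K) \<and>
       (\<forall>\<phi>. (\<forall>e. e \<notin> F \<times> UNIV \<longrightarrow> \<phi> e = 0) \<longrightarrow> (\<forall>g\<in>J. path_sum \<phi> g (relator s) = 0) \<longrightarrow>
         (\<forall>g. path_sum \<phi> g (relator s) = 0))" if F: "finite F" for F
    proof -
      define T where "T = F + K"
      have finT: "finite T" using F \<open>finite K\<close> by (simp add: T_def finite_set_plus)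
      have T_iff: "g \<in> T \<longleftrightarrow> (\<exists>x\<in>?S. \<exists>j<length s. g + x + elem (take j s) \<in> F)" for g
      proof
        assume "g \<in> T"
        then obtain f x j where "f \<in> F" "x \<in> ?S" "j < length s" "g = f + - (x + elem (take j s))"
          by (auto simp: T_def K_def set_plus_def)
        then show "\<exists>x\<in>?S. \<exists>j<length s. g + x + elem (take j s) \<in> F"
          by (intro bexI[of _ x] exI[of _ j]) (simp_all add: add.assoc)
      next
        assume "\<exists>x\<in>?S. \<exists>j<length s. g + x + elem (take j s) \<in> F"
        then obtain x j where *: "x \<in> ?S" "j < length s" "g + x + elem (take j s) \<in> F" by blast
        then have "- (x + elem (take j s)) \<in> K" by (auto simp: K_def)
        with *(3) have "g + x + elem (take j s) + - (x + elem (take j s)) \<in> T"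
          unfolding T_def by (rule set_plus_intro)
        then show "g \<in> T" by (simp add: add.assoc)
      qed
      have T_add: "g + y \<in> T" if gT: "g \<in> T" and y: "y \<in> ?S" for g y
      proof -
        obtain x j where *: "x \<in> ?S" "j < length s" "g + x + elem (take j s) \<in> F"
          using gT unfolding T_iff by blast
        have "- y + x \<in> ?S" using S_add[OF S_minus[OF y] *(1)] .
        moreover have "g + y + (- y + x) + elem (take j s) \<in> F" using *(3) by (simp add: add.assoc)
        ultimately show ?thesis unfolding T_iff using *(2) by blast
      qed
      define \<O> where "\<O> = (\<lambda>g. (+) g ` ?S) ` T"
      have fin\<O>: "finite \<O>" using finT by (simp add: \<O>_def)
      have un: "\<Union>\<O> = T"
        using T_add zero_in_multiples[of a] by (force simp: \<O>_def)
      have "exponent s * card \<O> = card (\<Union>\<O>)"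
      proof (rule card_partition[OF fin\<O>])
        show "finite (\<Union>\<O>)" using finT un by simp
        show "card c = exponent s" if "c \<in> \<O>" for c
          using that S(2) by (auto simp: \<O>_def card_image)
        show "c \<inter> d = {}" if cd: "c \<in> \<O>" "d \<in> \<O>" "c \<noteq> d" for c d
        proof (rule ccontr)
          assume "c \<inter> d \<noteq> {}"
          obtain g where g: "c = (+) g ` ?S" using cd(1) by (auto simp: \<O>_def)
          obtain h where h: "d = (+) h ` ?S" using cd(2) by (auto simp: \<O>_def)
          note gh = g h
          then obtain x y where xy: "x \<in> ?S" "y \<in> ?S" "g + x = h + y" using \<open>c \<inter> d \<noteq> {}\<close> by auto
          have sub: "(+) g ` ?S \<subseteq> (+) h ` ?S"
            if xy: "x \<in> ?S" "y \<in> ?S" "g + x = h + y" for g h x y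
          proof (rule image_subsetI)
            fix z assume z: "z \<in> ?S"
            have "g = h + y - x" using xy(3) by (metis add_diff_cancel)
            then have "g + z = h + (y + (- x + z))" by (simp only: diff_conv_add_uminus add.assoc)
            moreover have "y + (- x + z) \<in> ?S" using S_add S_minus xy z by blast
            ultimately show "g + z \<in> (+) h ` ?S" by blast
          qed
          show False using sub[OF xy] sub[OF xy(2,1) xy(3)[symmetric]] gh \<open>c \<noteq> d\<close> by blast
        qed
      qed
      then have card\<O>: "exponent s * card \<O> = card T" by (simp only: un)
      define J where "J = (\<lambda>c. SOME g. g \<in> c) ` \<O>"
      have "card J \<le> card \<O>" unfolding J_def by (rule card_image_le[OF fin\<O>])
      then have "exponent s * card J \<le> card T" using card\<O> by (metis mult_le_mono2)
      moreover have "finite J" using fin\<O> by (simp add: J_def)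
      moreover have "path_sum \<phi> g (relator s) = 0"
        if supp: "\<forall>e. e \<notin> F \<times> UNIV \<longrightarrow> \<phi> e = 0" and J: "\<forall>g\<in>J. path_sum \<phi> g (relator s) = 0" for \<phi> g
      proof (cases "g \<in> T")
        case True
        let ?h = "SOME h. h \<in> (+) g ` ?S"
        have "?h \<in> (+) g ` ?S" using zero_in_multiples by (intro someI_ex[of "\<lambda>h. h \<in> (+) g ` ?S"]) blast
        then obtain x where "x \<in> ?S" "?h = g + x" by blast
        moreover have "?h \<in> J" using True by (auto simp: J_def \<O>_def)
        ultimately show ?thesis using J path_sum_relator_shift[of x s \<phi> g] by (simp add: a_def)
      next
        case False
        show ?thesis unfolding relator_def
        proof (rule path_sum_wpow_eq_0[OF a_def _ _ False])
          show "x - a \<in> T" if "x \<in> T" for x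
            using T_add[OF that S_minus[OF in_multiples]] by simp
          show "path_sum \<phi> x s = 0" if x: "x \<notin> T" for x
          proof (rule path_sum_eq_0)
            fix j assume "j < length s"
            then have "x + 0 + elem (take j s) \<notin> F" using x zero_in_multiples unfolding T_iff by blast
            then show "\<phi> (x + elem (take j s), s ! j) = 0" using supp by simp
          qed
        qed
      qed
      ultimately show ?thesis unfolding T_def by blast
    qed
    then show ?thesis using \<open>finite K\<close> by blast
  qed
qed

text \<open>
  With boundary proportions of \<open>1/10\<close>, the three estimates of the introduction would give
  \<open>2 \<le> 11/10 * 1/2 + (11/10)\<^sup>2\<close>, which is false.
\<close>

lemma torsion_expanding:
  "\<exists>K :: torsion set. finite K \<and> (\<forall>F. finite F \<longrightarrow> F \<noteq> {} \<longrightarrow> 11 / 10 * real (card F) < real (card (F + K)))"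
proof (rule ccontr)
  assume "\<not> ?thesis"
  then have folner: "\<exists>F. finite F \<and> F \<noteq> {} \<and> real (card (F + K)) \<le> 11 / 10 * real (card F)"
    if "finite K" for K :: "torsion set" using that by (meson not_le)
  define X :: "torsion set" where "X = {0, elem [True], elem [False]}"
  have "finite X" by (simp add: X_def)
  from folner[OF this] obtain F where F: "finite F" "F \<noteq> {}"
    and FX: "real (card (F + X)) \<le> 11 / 10 * real (card F)" by blast
  obtain R where R: "finite R" and
    gradients: "card (traces (closed_cochains R) (F \<times> UNIV)) \<le> 2 ^ card (F + X)"
    using card_traces_closed_cochains_le[OF F(1)] unfolding X_def by blast
  let ?V = "closed_cochains R"
  obtain \<kappa> where \<kappa>: "\<And>s. finite (\<kappa> s)"
    "\<And>s F'. finite F' \<Longrightarrow> \<exists>J. finite J \<and> exponent s * card J \<le> card (F' + \<kappa> s) \<and>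
       (\<forall>\<phi>. (\<forall>e. e \<notin> F' \<times> UNIV \<longrightarrow> \<phi> e = 0) \<longrightarrow> (\<forall>g\<in>J. path_sum \<phi> g (relator s) = 0) \<longrightarrow>
         (\<forall>g. path_sum \<phi> g (relator s) = 0))"
    using relator_conditions by metis
  \<comment> \<open>The part \<open>uminus ` F\<close> bounds the number of translates of \<open>F\<close> that meet \<open>F'\<close>.\<close>
  define K where "K = (\<Union>s\<in>R. \<kappa> s) \<union> uminus ` F"
  have "finite K" using R F \<kappa>(1) by (simp add: K_def)
  from folner[OF this] obtain F' where F': "finite F'" "F' \<noteq> {}"
    and F'K: "real (card (F' + K)) \<le> 11 / 10 * real (card F')" by blast
  have finF'K: "finite (F' + K)" using F' \<open>finite K\<close> by (simp add: finite_set_plus)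
  obtain J where J: "\<And>s. finite (J s)" "\<And>s. exponent s * card (J s) \<le> card (F' + \<kappa> s)"
    "\<And>s \<phi> g. \<forall>e. e \<notin> F' \<times> UNIV \<longrightarrow> \<phi> e = 0 \<Longrightarrow> \<forall>g\<in>J s. path_sum \<phi> g (relator s) = 0 \<Longrightarrow>
         path_sum \<phi> g (relator s) = 0"
    using \<kappa>(2)[OF F'(1)] by metis
  define E :: "(torsion \<times> bool) set" where "E = F' \<times> UNIV"
  have "finite E" using F' by (simp add: E_def)
  have cardE: "card E = 2 * card F'" by (simp add: E_def card_cartesian_product)
  let ?W = "{\<phi> :: torsion \<times> bool \<Rightarrow> bit. \<forall>e. e \<notin> E \<longrightarrow> \<phi> e = 0}"
  let ?c = "\<lambda>(s, g) \<phi>. path_sum \<phi> g (relator s)"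
  define m where "m = card (Sigma R J)"
  have finJ: "finite (Sigma R J)" using R J(1) by simp
  have "2 ^ card E = card ?W" by (rule card_supported[OF \<open>finite E\<close>, symmetric])
  also have "\<dots> \<le> 2 ^ m * card {\<phi> \<in> ?W. \<forall>j\<in>Sigma R J. ?c j \<phi> = 0}"
    unfolding m_def
  proof (rule card_le_kernels[OF finJ])
    show "finite ?W" by (rule finite_supported[OF \<open>finite E\<close>])
    show "bit_space ?W" by (auto simp: bit_space_def)
  qed (auto simp: path_sum_add)
  also have "card {\<phi> \<in> ?W. \<forall>j\<in>Sigma R J. ?c j \<phi> = 0} \<le> card (traces ?V E)"
  proof (rule card_mono[OF finite_traces[OF \<open>finite E\<close>]], rule subsetI)
    fix \<phi> assume \<phi>: "\<phi> \<in> {\<phi> \<in> ?W. \<forall>j\<in>Sigma R J. ?c j \<phi> = 0}"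
    then have "\<phi> \<in> ?V" using J(3) by (auto simp: closed_cochains_def E_def)
    moreover have "restr E \<phi> = \<phi>" using \<phi> by (auto simp: restr_def fun_eq_iff)
    ultimately show "\<phi> \<in> traces ?V E" unfolding traces_def by (metis imageI)
  qed
  finally have lower: "2 ^ card E \<le> 2 ^ m * card (traces ?V E)" by simp
  define I where "I = F' + uminus ` F"
  have "finite I" using F F' by (simp add: I_def finite_set_plus)
  have "card (traces ?V E) ^ card F \<le> (\<Prod>g\<in>I. card (traces ?V (((+) g ` F) \<times> UNIV \<inter> E)))"
  proof (rule shearer_traces[OF bit_space_closed_cochains \<open>finite E\<close> \<open>finite I\<close>])
    fix e assume "e \<in> E"
    then obtain y b where e: "e = (y, b)" "y \<in> F'" by (auto simp: E_def)
    \<comment> \<open>Each vertex \<open>y\<close> of \<open>F'\<close> lies in \<open>card F\<close> translates of \<open>F\<close>.\<close>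
    have "(\<lambda>f. y - f) ` F \<subseteq> {g \<in> I. e \<in> (+) g ` F \<times> UNIV}"
    proof (rule image_subsetI)
      fix f assume f: "f \<in> F"
      have "y - f \<in> I" unfolding I_def diff_conv_add_uminus
        using e(2) f by (intro set_plus_intro imageI)
      moreover have "y = (y - f) + f" by simp
      ultimately show "y - f \<in> {g \<in> I. e \<in> (+) g ` F \<times> UNIV}" using f e(1) by blast
    qed
    then have "card ((\<lambda>f. y - f) ` F) \<le> card {g \<in> I. e \<in> (+) g ` F \<times> UNIV}"
      using \<open>finite I\<close> by (intro card_mono) auto
    moreover have "inj_on (\<lambda>f. y - f) F"
      by (rule inj_onI) (simp add: diff_conv_add_uminus del: add_uminus_conv_diff)
    ultimately show "card F \<le> card {g \<in> I. e \<in> (+) g ` F \<times> UNIV}" by (simp add: card_image)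
  qed
  also have "\<dots> \<le> (\<Prod>g\<in>I. card (traces ?V (F \<times> UNIV)))"
  proof (rule prod_mono, rule conjI)
    fix g
    show "card (traces ?V (((+) g ` F) \<times> UNIV \<inter> E)) \<le> card (traces ?V (F \<times> UNIV))"
      unfolding card_traces_translate[of R g F, symmetric] using F by (intro card_traces_mono) auto
  qed simp
  also have "\<dots> \<le> (2 ^ card (F + X)) ^ card I" using gradients by (simp add: power_mono)
  finally have upper: "card (traces ?V E) ^ card F \<le> 2 ^ (card (F + X) * card I)"
    by (simp add: power_mult)
  have "(2::nat) ^ (card E * card F) = (2 ^ card E) ^ card F" by (rule power_mult)
  also have "\<dots> \<le> (2 ^ m * card (traces ?V E)) ^ card F" using lower by (rule power_mono) simp
  also have "\<dots> = 2 ^ (m * card F) * card (traces ?V E) ^ card F"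
    by (simp add: power_mult_distrib power_mult)
  also have "\<dots> \<le> 2 ^ (m * card F) * 2 ^ (card (F + X) * card I)" using upper by simp
  also have "\<dots> = 2 ^ (m * card F + card (F + X) * card I)" by (simp add: power_add)
  finally have "card E * card F \<le> m * card F + card (F + X) * card I"
    by (rule power_le_imp_le_exp[rotated]) simp
  then have count: "2 * real (card F') * real (card F) \<le>
      real m * real (card F) + real (card (F + X)) * real (card I)"
    unfolding cardE by (simp only: of_nat_le_iff[where 'a = real, symmetric] of_nat_mult of_nat_add of_nat_numeral)
  have "card (F' + \<kappa> s) \<le> card (F' + K)" if "s \<in> R" for s
    using that by (intro card_mono finF'K set_plus_mono2) (auto simp: K_def)
  then have "exponent s * card (J s) \<le> card (F' + K)" if "s \<in> R" for s
    using J(2)[of s] that le_trans by blast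
  then have "real (card (J s)) \<le> card (F' + K) * (1 / exponent s)" if "s \<in> R" for s
    using that exponent_pos[of s]
    by (simp add: pos_le_divide_eq mult.commute of_nat_le_iff[where 'a = real, symmetric] del: of_nat_le_iff)
  then have "real m \<le> (\<Sum>s\<in>R. card (F' + K) * (1 / exponent s))"
    unfolding m_def using R J(1) by (simp add: card_SigmaI sum_mono)
  also have "\<dots> = card (F' + K) * (\<Sum>s\<in>R. 1 / exponent s)" by (rule sum_distrib_left[symmetric])
  also have "\<dots> \<le> card (F' + K) * (1 / 2)"
    using sum_inverse_exponents[OF R] by (intro mult_left_mono) auto
  finally have "real m \<le> 11 / 20 * card F'" using F'K by simp
  then have "real m * real (card F) \<le> 11 / 20 * card F' * card F" by (intro mult_right_mono) auto
  moreover have "card I \<le> card (F' + K)"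
    unfolding I_def by (intro card_mono finF'K set_plus_mono2) (auto simp: K_def)
  then have "real (card I) \<le> 11 / 10 * card F'" using F'K by linarith
  then have "real (card (F + X)) * real (card I) \<le> (11 / 10 * card F) * (11 / 10 * card F')"
    using FX by (intro mult_mono) auto
  moreover have "0 < real (card F) * real (card F')" using F F' by (simp add: card_gt_0_iff)
  ultimately show False using count by (simp add: field_simps)
qed

section \<open>Criteria for weak amenability and for the absence of free subgroups\<close>

text \<open>
  The normalised indicator of a finite set \<open>A\<close> is moved by \<open>s\<close> by the square root of the proportion of the
  symmetric difference of \<open>A\<close> and its translate, which is twice the proportion in the hypothesis as both
  sets have the same size.
\<close>

lemma weakly_amenable_if_folner:
  assumes "group G"
    and folner: "\<And>\<epsilon>::real. 0 < \<epsilon> \<Longrightarrow> \<exists>S A. finite S \<and> generating_set G S \<and> finite A \<and> A \<noteq> {} \<and> A \<subseteq> carrier G \<and>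
      (\<forall>s\<in>S. real (card ((s <#\<^bsub>G\<^esub> A) - A)) \<le> \<epsilon> * card A)"
  shows "weakly_amenable G"
proof -
  interpret group G by fact
  have alpha_le: "alpha G \<le> ennreal \<delta>" if "0 < \<delta>" for \<delta> :: real
  proof -
    have "0 < \<delta>\<^sup>2 / 2" using that by simp
    from folner[OF this] obtain S A where S: "finite S" "generating_set G S"
      and A: "finite A" "A \<noteq> {}" "A \<subseteq> carrier G"
      and SA: "\<And>s. s \<in> S \<Longrightarrow> real (card ((s <#\<^bsub>G\<^esub> A) - A)) \<le> \<delta>\<^sup>2 / 2 * card A" by blast
    define c where "c = 1 / sqrt (card A)"
    have c: "c\<^sup>2 * card A = 1" using A by (simp add: c_def power_divide card_gt_0_iff)
    define v where "v = (\<lambda>x. if x \<in> A then complex_of_real c else 0)"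
    have v_sq: "(cmod (v x))\<^sup>2 = (if x \<in> A then c\<^sup>2 else 0)" for x by (simp add: v_def)
    have "v \<in> ell2 G"
      unfolding ell2_def
      by (auto simp: v_def intro!: finite_nonzero_values_imp_summable_on finite_subset[OF _ A(1)] split: if_splits)
    have infsum_indicator: "(\<Sum>\<^sub>\<infinity>x\<in>carrier G. if x \<in> B then c\<^sup>2 else 0) = c\<^sup>2 * card B"
      if "finite B" "B \<subseteq> carrier G" for B
    proof -
      have "(\<Sum>\<^sub>\<infinity>x\<in>carrier G. if x \<in> B then c\<^sup>2 else 0) = (\<Sum>\<^sub>\<infinity>x\<in>B. c\<^sup>2)"
        by (rule infsum_cong_neutral) (use that in auto)
      then show ?thesis using that by (simp add: mult.commute)
    qed
    have "ell2_norm G v = 1"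
      unfolding ell2_norm_def v_sq using infsum_indicator[OF A(1,3)] c by simp
    have small: "ell2_norm G (\<lambda>x. left_regular G s v x - v x) \<le> \<delta>" if s: "s \<in> S" for s
    proof -
      have sG: "s \<in> carrier G" using s S by (auto simp: generating_set_def)
      let ?sA = "s <#\<^bsub>G\<^esub> A"
      let ?B = "(?sA - A) \<union> (A - ?sA)"
      have sA: "?sA \<subseteq> carrier G" "finite ?sA" using sG A by (auto simp: l_coset_def)
      have card_sA: "card ?sA = card A"
      proof -
        have "?sA = (\<lambda>x. s \<otimes>\<^bsub>G\<^esub> x) ` A" by (auto simp: l_coset_def)
        moreover have "inj_on (\<lambda>x. s \<otimes>\<^bsub>G\<^esub> x) A"
          using inj_on_cmult[OF sG] A(3) by (rule inj_on_subset)
        ultimately show ?thesis by (simp add: card_image)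
      qed
      have mem: "inv\<^bsub>G\<^esub> s \<otimes>\<^bsub>G\<^esub> x \<in> A \<longleftrightarrow> x \<in> ?sA" if "x \<in> carrier G" for x
      proof
        assume "inv\<^bsub>G\<^esub> s \<otimes>\<^bsub>G\<^esub> x \<in> A"
        moreover have "x = s \<otimes>\<^bsub>G\<^esub> (inv\<^bsub>G\<^esub> s \<otimes>\<^bsub>G\<^esub> x)" 
          using sG that m_assoc[of s "inv\<^bsub>G\<^esub> s" x] by simp
        ultimately show "x \<in> ?sA" by (auto simp: l_coset_def)
      next
        assume "x \<in> ?sA"
        then obtain y where "y \<in> A" "x = s \<otimes>\<^bsub>G\<^esub> y" by (auto simp: l_coset_def)
        moreover have "inv\<^bsub>G\<^esub> s \<otimes>\<^bsub>G\<^esub> (s \<otimes>\<^bsub>G\<^esub> y) = y"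
          using sG subsetD[OF A(3) \<open>y \<in> A\<close>] m_assoc[of "inv\<^bsub>G\<^esub> s" s y] by simp
        ultimately show "inv\<^bsub>G\<^esub> s \<otimes>\<^bsub>G\<^esub> x \<in> A" by simp
      qed
      have "(\<Sum>\<^sub>\<infinity>x\<in>carrier G. (cmod (left_regular G s v x - v x))\<^sup>2) =
          (\<Sum>\<^sub>\<infinity>x\<in>carrier G. if x \<in> ?B then c\<^sup>2 else 0)"
        by (rule infsum_cong) (simp add: left_regular_def v_def mem)
      also have "\<dots> = c\<^sup>2 * card ?B" using sA A by (intro infsum_indicator) auto
      also have "card ?B = card (?sA - A) + card (A - ?sA)"
        using sA A by (intro card_Un_disjoint) auto
      also have "card (A - ?sA) = card (?sA - A)"
        using card_sA sA(2) A(1) by (metis card_le_sym_Diff order_antisym order_refl)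
      also have "c\<^sup>2 * real (card (?sA - A) + card (?sA - A)) \<le> c\<^sup>2 * (\<delta>\<^sup>2 * card A)"
        using SA[OF s] by (intro mult_left_mono) auto
      also have "\<dots> = \<delta>\<^sup>2" using c by (simp add: mult_ac)
      finally show ?thesis unfolding ell2_norm_def using \<open>0 < \<delta>\<close> by (intro real_le_lsqrt) auto
    qed
    have "alpha_gen G S \<le> ennreal \<delta>"
      unfolding alpha_gen_def
    proof (rule Sup_least, clarify)
      fix \<epsilon> :: real
      assume "\<forall>v\<in>ell2 G. ell2_norm G v = 1 \<longrightarrow> (\<exists>s\<in>S. \<epsilon> \<le> ell2_norm G (\<lambda>x. left_regular G s v x - v x))"
      from bspec[OF this \<open>v \<in> ell2 G\<close>, THEN mp, OF \<open>ell2_norm G v = 1\<close>]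
      obtain s where "s \<in> S" "\<epsilon> \<le> ell2_norm G (\<lambda>x. left_regular G s v x - v x)" by (elim bexE)
      then show "ennreal \<epsilon> \<le> ennreal \<delta>" using small[of s] by (intro ennreal_leI) linarith
    qed
    moreover have "alpha G \<le> alpha_gen G S"
      unfolding alpha_def using S by (intro Inf_lower) blast
    ultimately show ?thesis by (rule order_trans[rotated])
  qed
  have "alpha G \<le> 0"
    by (rule ennreal_le_epsilon) (simp only: add_0 alpha_le)
  moreover obtain S where "finite S" "generating_set G S"
    using folner[OF zero_less_one] by blast
  then have "finitely_generated G" unfolding finitely_generated_def by blast
  ultimately show ?thesis by (simp add: weakly_amenable_def)
qed

lemma word_value_append:
  assumes "group G" "snd ` set u \<subseteq> carrier G" "snd ` set v \<subseteq> carrier G"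
  shows "word_value G (u @ v) = word_value G u \<otimes>\<^bsub>G\<^esub> word_value G v"
proof -
  interpret group G by fact
  have closed: "word_value G w \<in> carrier G" if "snd ` set w \<subseteq> carrier G" for w
    using that by (induction w) (auto simp: word_value_def)
  show "word_value G (u @ v) = word_value G u \<otimes>\<^bsub>G\<^esub> word_value G v"
    using assms(2)
  proof (induction u)
    case Nil
    show ?case using closed[OF assms(3)] by (simp add: word_value_def)
  next
    case (Cons p u)
    obtain b x where p: "p = (b, x)" by (cases p)
    let ?x = "if b then x else inv\<^bsub>G\<^esub> x"
    have "?x \<in> carrier G" using Cons.prems by (simp add: p)
    moreover have "word_value G u \<in> carrier G" using Cons.prems by (intro closed) auto
    ultimately have "?x \<otimes>\<^bsub>G\<^esub> word_value G u \<otimes>\<^bsub>G\<^esub> word_value G v =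
        ?x \<otimes>\<^bsub>G\<^esub> (word_value G u \<otimes>\<^bsub>G\<^esub> word_value G v)"
      using closed[OF assms(3)] by (rule m_assoc)
    moreover have "word_value G (u @ v) = word_value G u \<otimes>\<^bsub>G\<^esub> word_value G v"
      using Cons by simp
    moreover have "word_value G ((p # u) @ v) = ?x \<otimes>\<^bsub>G\<^esub> word_value G (u @ v)"
      "word_value G (p # u) = ?x \<otimes>\<^bsub>G\<^esub> word_value G u"
      by (simp_all add: word_value_def p)
    ultimately show ?case by simp
  qed
qed

text \<open>
  A free basis of a non-commutative subgroup has two distinct elements \<open>x\<close> and \<open>y\<close>.  Their commutator lies
  in the kernel of \<open>q\<close>, so one of its powers is trivial, although the powers of the word
  \<open>x y x\<^sup>-\<^sup>1 y\<^sup>-\<^sup>1\<close> are reduced.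
\<close>

lemma no_free_subgroup_if_torsion_kernel:
  fixes q :: "'a \<Rightarrow> int"
  assumes "group G"
    and q: "\<And>x y. x \<in> carrier G \<Longrightarrow> y \<in> carrier G \<Longrightarrow> q (x \<otimes>\<^bsub>G\<^esub> y) = q x + q y"
    and torsion: "\<And>x. x \<in> carrier G \<Longrightarrow> q x = 0 \<Longrightarrow> \<exists>n>0. x [^]\<^bsub>G\<^esub> (n::nat) = \<one>\<^bsub>G\<^esub>"
  shows "\<not> has_nonabelian_free_subgroup G"
proof
  interpret group G by fact
  assume "has_nonabelian_free_subgroup G"
  then obtain H X where H: "subgroup H G" and noncomm: "\<not> comm_group (G\<lparr>carrier := H\<rparr>)"
    and basis: "free_basis (G\<lparr>carrier := H\<rparr>) X"
    by (auto simp: has_nonabelian_free_subgroup_def free_group_def)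
  let ?H = "G\<lparr>carrier := H\<rparr>"
  interpret H: group ?H using H by (rule subgroup.subgroup_is_group) (rule assms(1))
  have XH: "X \<subseteq> H" and gen: "generate ?H X = H" using basis by (auto simp: free_basis_def generating_set_def)
  have HG: "H \<subseteq> carrier G" using H by (rule subgroup.subset)
  obtain x y where xy: "x \<in> X" "y \<in> X" "x \<noteq> y"
  proof (rule ccontr)
    assume "\<not> thesis"
    with that have "a = b" if "a \<in> X" "b \<in> X" for a b using \<open>a \<in> X\<close> \<open>b \<in> X\<close> by blast
    \<comment> \<open>With at most one basis element the subgroup would be cyclic.\<close>
    then obtain z where z: "z \<in> H" "X \<subseteq> {z}" using XH H.one_closed by (cases "X = {}") auto
    have pow: "\<exists>k::int. a = z [^]\<^bsub>?H\<^esub> k" if "a \<in> H" for a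
    proof -
      have "a \<in> generate ?H {z}" using that gen H.mono_generate[OF z(2)] by blast
      then show ?thesis using H.generate_pow[of z] z(1) by auto
    qed
    have "comm_group ?H"
    proof (rule H.group_comm_groupI)
      fix a b assume "a \<in> carrier ?H" "b \<in> carrier ?H"
      then have "a \<in> H" "b \<in> H" by simp_all
      obtain k :: int where k: "a = z [^]\<^bsub>?H\<^esub> k" using pow[OF \<open>a \<in> H\<close>] by (elim exE)
      obtain l :: int where l: "b = z [^]\<^bsub>?H\<^esub> l" using pow[OF \<open>b \<in> H\<close>] by (elim exE)
      note kl = k l
      have "z \<in> carrier ?H" using z(1) by simp
      then show "a \<otimes>\<^bsub>?H\<^esub> b = b \<otimes>\<^bsub>?H\<^esub> a"
        unfolding kl by (simp only: H.int_pow_mult[symmetric] add.commute)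
    qed
    then show False using noncomm by simp
  qed
  define c where "c = [(True, x), (True, y), (False, x), (False, y)]"
  have c_letters: "snd ` set c \<subseteq> X" using xy by (auto simp: c_def)
  have inv_eq: "inv\<^bsub>?H\<^esub> z = inv\<^bsub>G\<^esub> z" if "z \<in> H" for z
    using H that by (simp add: m_inv_consistent)
  have q1: "q \<one>\<^bsub>G\<^esub> = 0" using q[of "\<one>\<^bsub>G\<^esub>" "\<one>\<^bsub>G\<^esub>"] by simp
  have q_inv: "q (inv\<^bsub>G\<^esub> z) = - q z" if "z \<in> carrier G" for z
    using q[of z "inv\<^bsub>G\<^esub> z"] q1 that by simp
  have xyG: "x \<in> carrier G" "y \<in> carrier G" using xy XH HG by auto
  let ?g = "word_value ?H c"
  have "?g = x \<otimes>\<^bsub>G\<^esub> (y \<otimes>\<^bsub>G\<^esub> (inv\<^bsub>G\<^esub> x \<otimes>\<^bsub>G\<^esub> inv\<^bsub>G\<^esub> y))"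
    using xy XH xyG by (auto simp: c_def word_value_def inv_eq subsetD)
  then have g: "?g \<in> carrier G" "q ?g = 0" using xyG by (simp_all add: q q_inv)
  obtain n :: nat where n: "n > 0" "?g [^]\<^bsub>G\<^esub> n = \<one>\<^bsub>G\<^esub>" using torsion[OF g] by blast
  have letters: "snd ` set (wpow k c) \<subseteq> X" for k
    using c_letters by (induction k) auto
  have val: "word_value ?H (wpow k c) = ?g [^]\<^bsub>G\<^esub> k" for k
  proof (induction k)
    case (Suc k)
    have "word_value ?H (c @ wpow k c) = ?g \<otimes>\<^bsub>?H\<^esub> word_value ?H (wpow k c)"
      using c_letters letters[of k] XH by (intro word_value_append H.is_group) auto
    then show ?case unfolding wpow_simps nat_pow_Suc2[OF g(1)] using Suc by simp
  qed (simp add: word_value_def)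
  have "reduced_word (wpow k c) \<and> (k > 0 \<longrightarrow> hd (wpow k c) = (True, x))" for k
  proof (induction k)
    case (Suc k)
    have "wpow k c = [] \<or> hd (wpow k c) = (True, x)" using Suc by (cases k) auto
    then show ?case using Suc \<open>x \<noteq> y\<close>
      by (cases "wpow k c") (auto simp: reduced_word_def c_def)
  qed (simp add: reduced_word_def)
  then have "reduced_word (wpow n c)" by blast
  moreover have "wpow n c \<noteq> []" using n(1) by (cases n) (simp_all add: c_def)
  ultimately have "word_value ?H (wpow n c) \<noteq> \<one>\<^bsub>?H\<^esub>"
    using basis letters[of n] unfolding free_basis_def by blast
  then show False using val[of n] n(2) by simp
qed

section \<open>Lamplighter groups\<close>

text \<open>
  The restricted wreath product of \<open>'g\<close> with the integers: finitely supported lamp configurations,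
  translated by the integers.
\<close>

definition lamplighter :: "((int \<Rightarrow> 'g::group_add) \<times> int) monoid" where
  "lamplighter = \<lparr>carrier = {(f, j). finite {i. f i \<noteq> 0}},
     mult = (\<lambda>(f, j) (g, k). (\<lambda>i. f i + g (i - j), j + k)),
     one = (\<lambda>_. 0, 0)\<rparr>"

lemma lamplighter_simps [simp]:
  "(f, j) \<in> carrier lamplighter \<longleftrightarrow> finite {i. f i \<noteq> 0}"
  "(f, j) \<otimes>\<^bsub>lamplighter\<^esub> (g, k) = (\<lambda>i. f i + g (i - j), j + k)"
  "\<one>\<^bsub>lamplighter\<^esub> = (\<lambda>_. 0, 0)"
  by (simp_all add: lamplighter_def)

lemma finite_support_shift: "finite {i. f i \<noteq> 0} \<Longrightarrow> finite {i. f (i + k :: int) \<noteq> 0}"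
  by (rule finite_subset[of _ "(\<lambda>i. i - k) ` {i. f i \<noteq> 0}"]) (force simp: image_iff)+

lemma finite_support_add:
  "finite {i. f i \<noteq> 0} \<Longrightarrow> finite {i. g i \<noteq> 0} \<Longrightarrow> finite {i. f i + g i \<noteq> (0 :: 'g::monoid_add)}"
  by (rule finite_subset[of _ "{i. f i \<noteq> 0} \<union> {i. g i \<noteq> 0}"]) auto

lemma group_lamplighter: "group (lamplighter :: ((int \<Rightarrow> 'g::group_add) \<times> int) monoid)"
proof (rule groupI)
  fix x y z :: "(int \<Rightarrow> 'g) \<times> int"
  obtain f j g k h l where xyz: "x = (f, j)" "y = (g, k)" "z = (h, l)" by (metis surj_pair)
  show "x \<otimes>\<^bsub>lamplighter\<^esub> y \<in> carrier lamplighter" if "x \<in> carrier lamplighter" "y \<in> carrier lamplighter"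
    using that finite_support_shift[of g "- j"] by (simp add: xyz finite_support_add)
  show "x \<otimes>\<^bsub>lamplighter\<^esub> y \<otimes>\<^bsub>lamplighter\<^esub> z = x \<otimes>\<^bsub>lamplighter\<^esub> (y \<otimes>\<^bsub>lamplighter\<^esub> z)"
    by (simp add: xyz add.assoc diff_diff_eq)
  show "\<one>\<^bsub>lamplighter\<^esub> \<otimes>\<^bsub>lamplighter\<^esub> x = x" by (simp add: xyz)
  show "\<exists>y\<in>carrier lamplighter. y \<otimes>\<^bsub>lamplighter\<^esub> x = \<one>\<^bsub>lamplighter\<^esub>" if "x \<in> carrier lamplighter"
    using that finite_support_shift[of f j]
    by (intro bexI[of _ "(\<lambda>i. - f (i + j), - j)"]) (simp_all add: xyz)
qed simp

lemma lamplighter_pow: "(f, 0) [^]\<^bsub>lamplighter\<^esub> (n::nat) = (\<lambda>i. nmul n (f i), 0)"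
proof (induction n)
  case (Suc n)
  have "nmul n a + a = a + nmul n a" for a :: 'a
    using nmul_add[of n 1 a] nmul_add[of 1 n a] by simp
  then show ?case using Suc by simp
qed simp

lemma countable_lamplighter:
  assumes countable: "countable (UNIV :: 'g::group_add set)"
  shows "countable (carrier (lamplighter :: ((int \<Rightarrow> 'g) \<times> int) monoid))"
proof -
  let ?f = "\<lambda>(l :: (int \<times> 'g) list) i. case map_of l i of None \<Rightarrow> 0 :: 'g | Some g \<Rightarrow> g"
  have "countable (UNIV \<times> UNIV :: (int \<times> 'g) set)"
    by (intro countable_SIGMA countableI_type countable)
  then have "countable (lists (UNIV :: (int \<times> 'g) set))"
    unfolding UNIV_Times_UNIV by (rule countable_lists)
  then have "countable (range ?f)" by (simp only: lists_UNIV) (rule countable_image)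
  moreover have "f \<in> range ?f" if fin: "finite {i. f i \<noteq> 0}" for f
  proof -
    obtain ks where "set ks = {i. f i \<noteq> 0}" using finite_list[OF fin] by blast
    then have "f i = ?f (map (\<lambda>i. (i, f i)) ks) i" for i
      by (auto simp: map_of_map_restrict restrict_map_def)
    then show ?thesis by blast
  qed
  then have "carrier lamplighter \<subseteq> range ?f \<times> (UNIV :: int set)" by auto
  ultimately show ?thesis by (meson countable_SIGMA countable_subset countableI_type)
qed

definition lamp :: "int \<Rightarrow> 'g \<Rightarrow> (int \<Rightarrow> 'g::group_add) \<times> int" where
  "lamp i g = ((\<lambda>_. 0)(i := g), 0)"

definition move :: "int \<Rightarrow> (int \<Rightarrow> 'g::group_add) \<times> int" where
  "move j = (\<lambda>_. 0, j)"

text \<open>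
  The distance \<open>n\<close> between the two lamps is what makes these generating sets almost invariant.
\<close>

definition spread_gens :: "nat \<Rightarrow> ((int \<Rightarrow> torsion) \<times> int) set" where
  "spread_gens n = {move 1, lamp 0 (elem [True]), lamp (int n) (elem [False])}"

lemma lamp_move_closed [simp]: "lamp i g \<in> carrier lamplighter" "move j \<in> carrier lamplighter"
proof -
  have "finite {k. ((\<lambda>_. 0)(i := g)) k \<noteq> 0}" by (rule finite_subset[of _ "{i}"]) auto
  then show "lamp i g \<in> carrier lamplighter" by (simp only: lamp_def lamplighter_simps)
qed (simp add: move_def)

lemma lamp_move_mult:
  "lamp i g \<otimes>\<^bsub>lamplighter\<^esub> lamp i h = lamp i (g + h)"
  "move j \<otimes>\<^bsub>lamplighter\<^esub> move k = move (j + k)"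
  "move j \<otimes>\<^bsub>lamplighter\<^esub> lamp i g \<otimes>\<^bsub>lamplighter\<^esub> move (- j) = lamp (i + j) g"
  by (auto simp: lamp_def move_def fun_eq_iff)

text \<open>
  Conjugating by translations carries each of the two lamps to every position.
\<close>

lemma generating_set_spread_gens: "generating_set lamplighter (spread_gens n)"
proof -
  let ?G = "lamplighter :: ((int \<Rightarrow> torsion) \<times> int) monoid"
  interpret group ?G by (rule group_lamplighter)
  have sub: "spread_gens n \<subseteq> carrier ?G" by (simp add: spread_gens_def)
  define H where "H = generate ?G (spread_gens n)"
  have "subgroup H ?G" unfolding H_def by (rule generate_is_subgroup[OF sub])
  then interpret H: subgroup H ?G .
  have base: "move 1 \<in> H" "lamp 0 (elem [True]) \<in> H" "lamp (int n) (elem [False]) \<in> H"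
    unfolding H_def by (rule generate.incl, simp add: spread_gens_def)+
  have one: "\<one>\<^bsub>?G\<^esub> = move 0" "\<one>\<^bsub>?G\<^esub> = lamp i 0" for i by (simp_all add: move_def lamp_def fun_eq_iff)
  have nat_move: "move (int k) \<in> H" for k
  proof (induction k)
    case 0
    show ?case using H.one_closed one(1) by simp
  next
    case (Suc k)
    show ?case using H.m_closed[OF base(1) Suc] by (simp add: lamp_move_mult)
  qed
  have "move (- int k) \<in> H" for k
  proof -
    have "inv\<^bsub>?G\<^esub> (move (int k)) = move (- int k)"
      by (rule inv_equality) (simp_all add: lamp_move_mult one(1) del: lamplighter_simps)
    then show ?thesis using H.m_inv_closed[OF nat_move[of k]] by simp
  qed
  with nat_move have move: "move j \<in> H" for j by (cases j rule: int_cases2) auto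
  have translate: "lamp i g \<in> H" if "lamp i' g \<in> H" for i i' g
    using H.m_closed[OF H.m_closed[OF move[of "i - i'"] that] move[of "- (i - i')"]]
    unfolding lamp_move_mult(3) by simp
  have letter: "lamp i (elem [b]) \<in> H" for i b 
    by (cases b) (use translate[OF base(2)] translate[OF base(3)] in simp_all)
  have "lamp i (elem w) \<in> H" for i w
  proof (induction w)
    case Nil
    show ?case using H.one_closed one(2)[of i] by simp
  next
    case (Cons b w)
    show ?case using H.m_closed[OF letter[of i b] Cons] by (simp add: lamp_move_mult elem_Cons[of b w])
  qed
  then have lamp: "lamp i g \<in> H" for i g using elem_surj[of g] by blast
  have conf: "(f, 0) \<in> H" if "finite I" "{i. f i \<noteq> 0} \<subseteq> I" for f I
    using that
  proof (induction I arbitrary: f)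
    case empty
    then have "(f, 0) = \<one>\<^bsub>?G\<^esub>" by auto
    then show ?case using H.one_closed by simp
  next
    case (insert i I)
    have "(f(i := 0), 0) \<in> H" using insert.prems by (intro insert.IH) auto
    from H.m_closed[OF lamp[of i "f i"] this]
    have "(\<lambda>k. ((\<lambda>_. 0)(i := f i)) k + (f(i := 0)) k, 0) \<in> H" by (simp add: lamp_def)
    also have "(\<lambda>k. ((\<lambda>_. 0)(i := f i)) k + (f(i := 0)) k) = f" by auto
    finally show ?case .
  qed
  have "carrier ?G \<subseteq> H"
  proof
    fix x assume "x \<in> carrier ?G"
    then obtain f j where x: "x = (f, j)" "finite {i. f i \<noteq> 0}" by (cases x) auto
    have "(f, 0) \<otimes>\<^bsub>?G\<^esub> move j \<in> H" using conf[OF x(2) subset_refl] move by (rule H.m_closed)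
    then show "x \<in> H" by (simp add: x move_def)
  qed
  then have "H = carrier ?G" using H.subset by blast
  then show ?thesis using sub by (simp add: generating_set_def H_def)
qed

text \<open>
  During \<open>n\<close> unit moves the lamp \<open>elem [True]\<close> at position \<open>0\<close> acts, in the moving frame, at the positions
  \<open>{- n<..0}\<close>, and the lamp \<open>elem [False]\<close> at position \<open>n\<close> acts at the disjoint positions \<open>{0<..n}\<close>.
\<close>

definition window_values :: "nat \<Rightarrow> int \<Rightarrow> torsion set" where
  "window_values n i = (if i \<in> {- int n<..0} then multiples (elem [True])
     else if i \<in> {0<..int n} then multiples (elem [False]) else {0})"

definition windows :: "nat \<Rightarrow> (int \<Rightarrow> torsion) set" where
  "windows n = {f. \<forall>i. f i \<in> window_values n i}"

text \<open>
  In an element \<open>(f, j)\<close> of this Folner set, the configuration \<open>f\<close> taken in the moving frame is supported in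
  the two windows.  Both lamps preserve the set, and the unit move leaves it only from \<open>j = n - 1\<close>.
\<close>

definition swept :: "nat \<Rightarrow> ((int \<Rightarrow> torsion) \<times> int) set" where
  "swept n = (\<lambda>(f, j). (\<lambda>i. f (i - j), j)) ` (windows n \<times> {0..<int n})"

lemma finite_multiples: "finite (multiples (g :: torsion))"
  using torsion_exponent[of g] multiples_props(1)[of _ g] by (metis finite_imageI finite_lessThan)

lemma multiples_add: "x \<in> multiples g \<Longrightarrow> g + x \<in> multiples g" for g :: torsion
proof -
  obtain n where "0 < n" "nmul n g = 0" using torsion_exponent by blast
  then show "x \<in> multiples g \<Longrightarrow> g + x \<in> multiples g"
    using in_multiples by (rule multiples_props(2))
qed

lemma windowsD: "f \<in> windows n \<Longrightarrow> f i \<in> window_values n i"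
  unfolding windows_def by blast

lemma finite_windows: "finite (windows n)"
proof -
  let ?B = "multiples (elem [True]) \<union> multiples (elem [False])"
  have "windows n \<subseteq> {f. \<forall>i. (i \<in> {- int n<..int n} \<longrightarrow> f i \<in> ?B) \<and> (i \<notin> {- int n<..int n} \<longrightarrow> f i = 0)}"
  proof (rule subsetI, rule CollectI, rule allI)
    fix f i assume "f \<in> windows n"
    from windowsD[OF this, of i] show "(i \<in> {- int n<..int n} \<longrightarrow> f i \<in> ?B) \<and> (i \<notin> {- int n<..int n} \<longrightarrow> f i = 0)"
      using zero_in_multiples by (auto simp: window_values_def split: if_splits)
  qed
  then show ?thesis
    by (rule finite_subset) (intro finite_set_of_finite_funs finite_UnI finite_multiples, simp)
qed

lemma swept_subset: "swept n \<subseteq> carrier lamplighter"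
proof -
  have "finite {i. f (i - j) \<noteq> 0}" if "f \<in> windows n" for f j
  proof -
    have "i \<in> {- int n<..int n}" if "f i \<noteq> 0" for i
      using windowsD[OF \<open>f \<in> windows n\<close>, of i] that by (auto simp: window_values_def split: if_splits)
    then have "{i. f i \<noteq> 0} \<subseteq> {- int n<..int n}" by blast
    then have "finite {i. f i \<noteq> 0}" by (rule finite_subset) simp
    from finite_support_shift[OF this, of "- j"] show ?thesis by simp
  qed
  then show ?thesis by (auto simp: swept_def)
qed

lemma card_swept: "card (swept n) = card (windows n) * n"
proof -
  have "inj_on (\<lambda>(f, j). (\<lambda>i. f (i - j), j)) (windows n \<times> {0..<int n})"
  proof (rule inj_onI)
    fix p q :: "(int \<Rightarrow> torsion) \<times> int"
    obtain f j g k where pq: "p = (f, j)" "q = (g, k)" by (metis surj_pair)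
    assume "(\<lambda>(f, j). (\<lambda>i. f (i - j), j)) p = (\<lambda>(f, j). (\<lambda>i. f (i - j), j)) q"
    then have eq: "(\<lambda>i. f (i - j)) = (\<lambda>i. g (i - j))" and "j = k" by (auto simp: pq)
    have "f i = g i" for i using fun_cong[OF eq, of "i + j"] by simp
    then show "p = q" using \<open>j = k\<close> by (auto simp: pq)
  qed
  then show ?thesis by (simp add: swept_def card_image card_cartesian_product)
qed

lemma windows_update:
  assumes f: "f \<in> windows n"
  shows "i \<in> {- int n<..0} \<Longrightarrow> f(i := elem [True] + f i) \<in> windows n"
    and "i \<in> {0<..int n} \<Longrightarrow> f(i := elem [False] + f i) \<in> windows n"
proof -
  have upd: "f(i := g) \<in> windows n" if "g \<in> window_values n i" for g
    using that windowsD[OF f] unfolding windows_def by simp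
  show "f(i := elem [True] + f i) \<in> windows n" if "i \<in> {- int n<..0}"
    using windowsD[OF f, of i] that by (intro upd) (simp add: window_values_def multiples_add)
  show "f(i := elem [False] + f i) \<in> windows n" if "i \<in> {0<..int n}"
    using windowsD[OF f, of i] that by (intro upd) (simp add: window_values_def multiples_add)
qed

lemma swept_folner:
  assumes "s \<in> spread_gens n"
  shows "card ((s <#\<^bsub>lamplighter\<^esub> swept n) - swept n) \<le> card (windows n)"
proof -
  have lamp: "lamp i g <#\<^bsub>lamplighter\<^esub> swept n \<subseteq> swept n"
    if upd: "\<And>f j. f \<in> windows n \<Longrightarrow> j \<in> {0..<int n} \<Longrightarrow> f(i - j := g + f (i - j)) \<in> windows n" for i g
  proof
    fix x assume "x \<in> lamp i g <#\<^bsub>lamplighter\<^esub> swept n"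
    then obtain f j where *: "f \<in> windows n" "j \<in> {0..<int n}" "x = lamp i g \<otimes>\<^bsub>lamplighter\<^esub> (\<lambda>i. f (i - j), j)"
      by (auto simp: l_coset_def swept_def)
    then have "x = (\<lambda>(f, j). (\<lambda>i. f (i - j), j)) (f(i - j := g + f (i - j)), j)"
      by (auto simp: lamp_def fun_eq_iff)
    then show "x \<in> swept n" unfolding swept_def using upd[OF *(1,2)] *(2) by blast
  qed
  consider "s = move 1" | "s = lamp 0 (elem [True])" | "s = lamp (int n) (elem [False])"
    using assms by (auto simp: spread_gens_def)
  then show ?thesis
  proof cases
    case 1
    have "(s <#\<^bsub>lamplighter\<^esub> swept n) - swept n \<subseteq> (\<lambda>f. (\<lambda>i. f (i - int n), int n)) ` windows n"
    proof
      fix x assume x: "x \<in> (s <#\<^bsub>lamplighter\<^esub> swept n) - swept n"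
      then obtain f j where *: "f \<in> windows n" "j \<in> {0..<int n}" "x = s \<otimes>\<^bsub>lamplighter\<^esub> (\<lambda>i. f (i - j), j)"
        by (auto simp: l_coset_def swept_def)
      then have x_eq: "x = (\<lambda>(f, j). (\<lambda>i. f (i - j), j)) (f, j + 1)"
        by (simp add: 1 move_def algebra_simps)
      have "j + 1 \<notin> {0..<int n}"
      proof
        assume "j + 1 \<in> {0..<int n}"
        then have "x \<in> swept n" unfolding x_eq swept_def using *(1) by (intro imageI SigmaI)
        then show False using x by blast
      qed
      then have "j + 1 = int n" using *(2) by auto
      then show "x \<in> (\<lambda>f. (\<lambda>i. f (i - int n), int n)) ` windows n" using *(1) x_eq by auto
    qed
    then show ?thesis using finite_windows by (rule surj_card_le[rotated])
  next
    case 2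
    have "s <#\<^bsub>lamplighter\<^esub> swept n \<subseteq> swept n"
      unfolding 2 by (rule lamp) (auto intro: windows_update(1))
    then show ?thesis by (simp add: Diff_eq_empty_iff[THEN iffD2])
  next
    case 3
    have "s <#\<^bsub>lamplighter\<^esub> swept n \<subseteq> swept n"
      unfolding 3 by (rule lamp) (auto intro: windows_update(2))
    then show ?thesis by (simp add: Diff_eq_empty_iff[THEN iffD2])
  qed
qed

lemma lamplighter_folner:
  fixes \<epsilon> :: real
  assumes "0 < \<epsilon>"
  shows "\<exists>S A. finite S \<and> generating_set (lamplighter :: ((int \<Rightarrow> torsion) \<times> int) monoid) S \<and>
    finite A \<and> A \<noteq> {} \<and> A \<subseteq> carrier lamplighter \<and>
    (\<forall>s\<in>S. real (card ((s <#\<^bsub>lamplighter\<^esub> A) - A)) \<le> \<epsilon> * card A)"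
proof -
  obtain n :: nat where n: "0 < n" "1 / n < \<epsilon>"
    using real_arch_inverse[of \<epsilon>] assms by (auto simp: inverse_eq_divide)
  have "(\<lambda>_. 0) \<in> windows n" by (simp add: windows_def window_values_def zero_in_multiples)
  then have pos: "0 < card (windows n)" using finite_windows card_gt_0_iff by blast
  have "real (card ((s <#\<^bsub>lamplighter\<^esub> swept n) - swept n)) \<le> \<epsilon> * card (swept n)"
    if "s \<in> spread_gens n" for s
  proof -
    have "real (card ((s <#\<^bsub>lamplighter\<^esub> swept n) - swept n)) \<le> 1 * real (card (windows n))"
      using swept_folner[OF that] by simp
    also have "\<dots> \<le> (\<epsilon> * n) * real (card (windows n))"
      using n by (intro mult_right_mono) (auto simp: field_simps)
    finally show ?thesis by (simp add: card_swept mult_ac)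
  qed
  moreover have "finite (swept n)" using finite_windows by (simp add: swept_def)
  moreover have "swept n \<noteq> {}" using card_swept[of n] pos n(1) by auto
  moreover have "finite (spread_gens n)" by (simp add: spread_gens_def)
  ultimately show ?thesis using generating_set_spread_gens swept_subset by blast
qed

section \<open>The example\<close>

lemma nat_copy:
  assumes "group W" "countable (carrier W)"
  shows "\<exists>(G :: nat monoid) e. group G \<and> e \<in> iso W G"
proof -
  interpret group W by fact
  define e where "e = to_nat_on (carrier W)"
  have inj: "inj_on e (carrier W)" using assms(2) by (simp add: e_def inj_on_to_nat_on)
  define d where "d = inv_into (carrier W) e"
  have d: "d (e x) = x" if "x \<in> carrier W" for x using inj that by (simp add: d_def)
  define G where "G = \<lparr>carrier = e ` carrier W, mult = (\<lambda>x y. e (d x \<otimes>\<^bsub>W\<^esub> d y)), one = e \<one>\<^bsub>W\<^esub>\<rparr>"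
  have "e \<in> iso W G" using inj by (auto simp: iso_def hom_def bij_betw_def G_def d)
  moreover have "group (G\<lparr>one := e \<one>\<^bsub>W\<^esub>\<rparr>)" by (rule iso_imp_img_group[OF \<open>e \<in> iso W G\<close>])
  then have "group G" by (simp add: G_def)
  ultimately show ?thesis by blast
qed

theorem corollary2p4:
  "\<exists>G :: nat monoid. group G \<and> finitely_generated G \<and> weakly_amenable G \<and>
     \<not> amenable G \<and> \<not> has_nonabelian_free_subgroup G"
proof -
  let ?W = "lamplighter :: ((int \<Rightarrow> torsion) \<times> int) monoid"
  interpret W: group ?W by (rule group_lamplighter)
  have "UNIV = range elem" using elem_surj by (metis UNIV_eq_I rangeI)
  then have "countable (UNIV :: torsion set)" by (metis countable_image countableI_type)
  then obtain G :: "nat monoid" and e where G: "group G" and e: "e \<in> iso ?W G"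
    using nat_copy[OF group_lamplighter countable_lamplighter] by blast
  interpret G: group G by fact
  have hom: "e \<in> hom ?W G" and inj: "inj_on e (carrier ?W)" and onto: "e ` carrier ?W = carrier G"
    using e by (auto simp: iso_def bij_betw_def)
  interpret e: group_hom ?W G e using hom by unfold_locales
  have weak: "weakly_amenable G"
  proof (rule weakly_amenable_if_folner[OF G])
    fix \<epsilon> :: real assume "0 < \<epsilon>"
    from lamplighter_folner[OF this] obtain S A where S: "finite S" "generating_set ?W S"
      and A: "finite A" "A \<noteq> {}" "A \<subseteq> carrier ?W"
      and SA: "\<And>s. s \<in> S \<Longrightarrow> real (card ((s <#\<^bsub>?W\<^esub> A) - A)) \<le> \<epsilon> * card A" by blast
    have SW: "S \<subseteq> carrier ?W" and "generate ?W S = carrier ?W" using S(2) by (auto simp: generating_set_def)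
    then have "generate G (e ` S) = carrier G" using e.generate_img[OF SW] onto by simp
    then have "generating_set G (e ` S)" using SW onto by (auto simp: generating_set_def)
    moreover have "real (card ((e s <#\<^bsub>G\<^esub> e ` A) - e ` A)) \<le> \<epsilon> * card (e ` A)" if s: "s \<in> S" for s
    proof -
      have sub: "s <#\<^bsub>?W\<^esub> A \<subseteq> carrier ?W" using s SW A(3) by (intro W.l_coset_subset_G) auto
      have "e s <#\<^bsub>G\<^esub> e ` A = e ` (s <#\<^bsub>?W\<^esub> A)"
      proof -
        have "e (s \<otimes>\<^bsub>?W\<^esub> a) = e s \<otimes>\<^bsub>G\<^esub> e a" if "a \<in> A" for a
          using s SW A(3) that by (intro e.hom_mult) auto
        moreover have "e s <#\<^bsub>G\<^esub> e ` A = (\<lambda>a. e s \<otimes>\<^bsub>G\<^esub> e a) ` A" by (auto simp: l_coset_def)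
        moreover have "s <#\<^bsub>?W\<^esub> A = (\<lambda>a. s \<otimes>\<^bsub>?W\<^esub> a) ` A" by (auto simp: l_coset_def)
        ultimately show ?thesis by (simp only: image_image cong: image_cong)
      qed
      then have "(e s <#\<^bsub>G\<^esub> e ` A) - e ` A = e ` ((s <#\<^bsub>?W\<^esub> A) - A)"
        using inj_on_image_set_diff[OF inj, of "s <#\<^bsub>?W\<^esub> A" A] sub A(3) by auto
      then show ?thesis
        using SA[OF s] card_image[OF inj_on_subset[OF inj A(3)]]
          card_image_le[of "(s <#\<^bsub>?W\<^esub> A) - A" e] A(1) by (simp add: l_coset_def)
    qed
    ultimately show "\<exists>S A. finite S \<and> generating_set G S \<and> finite A \<and> A \<noteq> {} \<and> A \<subseteq> carrier G \<and>
      (\<forall>s\<in>S. real (card ((s <#\<^bsub>G\<^esub> A) - A)) \<le> \<epsilon> * card A)"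
      using S(1) A onto by (intro exI[of _ "e ` S"] exI[of _ "e ` A"]) auto
  qed
  define d where "d = inv_into (carrier ?W) e"
  have d: "d (e x) = x" if "x \<in> carrier ?W" for x using inj that by (simp add: d_def)
  have carrier_G: "\<exists>f j. x = e (f, j) \<and> (f, j) \<in> carrier ?W" if "x \<in> carrier G" for x
    using that onto by (metis imageE surj_pair)
  have mult_e: "e x \<otimes>\<^bsub>G\<^esub> e y = e (x \<otimes>\<^bsub>?W\<^esub> y)" if "x \<in> carrier ?W" "y \<in> carrier ?W" for x y
    using that by simp
  have "\<not> has_nonabelian_free_subgroup G"
  proof (rule no_free_subgroup_if_torsion_kernel[OF G, where q = "\<lambda>x. snd (d x)"])
    fix x y assume "x \<in> carrier G" "y \<in> carrier G"
    then obtain f j g k where *: "x = e (f, j)" "(f, j) \<in> carrier ?W" "y = e (g, k)" "(g, k) \<in> carrier ?W"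
      using carrier_G by metis
    have "d (x \<otimes>\<^bsub>G\<^esub> y) = (f, j) \<otimes>\<^bsub>?W\<^esub> (g, k)"
      unfolding *(1,3) mult_e[OF *(2,4)] by (rule d[OF W.m_closed[OF *(2,4)]])
    then show "snd (d (x \<otimes>\<^bsub>G\<^esub> y)) = snd (d x) + snd (d y)"
      using d[OF *(2)] d[OF *(4)] by (simp add: *(1,3))
  next
    fix x assume "x \<in> carrier G" and "snd (d x) = 0"
    then obtain f where x: "x = e (f, 0)" "(f, 0) \<in> carrier ?W" using carrier_G d by (metis snd_conv)
    define I where "I = {i. f i \<noteq> 0}"
    have I: "finite I" using x(2) by (simp add: I_def)
    define r where "r i = (SOME n. 0 < n \<and> nmul n (f i) = 0)" for i
    have "0 < r i \<and> nmul (r i) (f i) = 0" for i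
      unfolding r_def by (rule someI_ex) (rule torsion_exponent)
    then have r: "\<And>i. 0 < r i" "\<And>i. nmul (r i) (f i) = 0" by blast+
    \<comment> \<open>An exponent that kills every lamp of the finite configuration.\<close>
    let ?n = "\<Prod>i\<in>I. r i"
    have "nmul ?n (f i) = 0" for i
    proof (cases "i \<in> I")
      case True
      then show ?thesis using nmul_mult_eq_0[OF r(2)[of i]] prod.remove[OF I True, of r] by simp
    next
      case False
      then show ?thesis by (simp add: I_def nmul_zero)
    qed
    then have "(f, 0) [^]\<^bsub>?W\<^esub> ?n = \<one>\<^bsub>?W\<^esub>" by (simp add: lamplighter_pow)
    then have "x [^]\<^bsub>G\<^esub> ?n = \<one>\<^bsub>G\<^esub>" using e.hom_nat_pow[OF x(2), of ?n] x(1) e.hom_one by simp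
    moreover have "0 < ?n" using r(1) by (simp add: prod_pos)
    ultimately show "\<exists>n>0. x [^]\<^bsub>G\<^esub> (n::nat) = \<one>\<^bsub>G\<^esub>" by blast
  qed
  moreover have "\<not> amenable G"
  proof -
    obtain K :: "torsion set" where K: "finite K"
      "\<And>F. finite F \<Longrightarrow> F \<noteq> {} \<Longrightarrow> 11 / 10 * real (card F) < real (card (F + K))"
      using torsion_expanding by blast
    show ?thesis
    proof (rule expanding_imp_paradox[OF _ K])
      fix L and f :: "torsion \<times> bool \<Rightarrow> torsion"
      assume f: "finite L" "inj f" "\<And>p. f p - fst p \<in> L"
      show "\<not> amenable G"
      proof (rule not_amenable_if_paradox[OF f G, where h = "\<lambda>g. e (lamp 0 g)" and c = "\<lambda>x. fst (d x) 0"])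
        show "e (lamp 0 g) \<in> carrier G" for g using onto lamp_move_closed(1) by blast
        fix g x assume "x \<in> carrier G"
        then obtain f j where x: "x = e (f, j)" "(f, j) \<in> carrier ?W" using carrier_G by blast
        have "d (e (lamp 0 g) \<otimes>\<^bsub>G\<^esub> x) = lamp 0 g \<otimes>\<^bsub>?W\<^esub> (f, j)"
          unfolding x(1) mult_e[OF lamp_move_closed(1) x(2)] by (rule d[OF W.m_closed[OF lamp_move_closed(1) x(2)]])
        then show "fst (d (e (lamp 0 g) \<otimes>\<^bsub>G\<^esub> x)) 0 = g + fst (d x) 0"
          using d[OF x(2)] by (simp add: x(1) lamp_def)
      qed
    qed simp
  qed
  moreover have "finitely_generated G" using weak by (simp add: weakly_amenable_def)
  ultimately show ?thesis using G weak by blast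
qed

end
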